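(* Let $n\ge 8$ be an integer with $8\mid n$, and assume that each prime factor of $n$ is either $2$ or greater than $5$. Assume that $(x_0,\dots,x_4)\in G^5$ satisfies $(\tan x_0)^2=(\tan x_1)(\tan x_2)(\tan x_3)(\tan x_4)$ with $0<x_i<\frac{\pi}{2}$ and $\operatorname{den}(x_i)=n$ for each $0\le i\le 4$. Then there exist a permutation $\sigma$ of $\{1,2,3,4\}$ and rationals $s,t$ with $0<s<\frac12$, $0<t\le\frac14$ such that $x_0=x_{\sigma(1)}=x_{\sigma(2)}=s\pi$, $x_{\sigma(3)}=t\pi$ and $x_{\sigma(4)}=(\frac12-t)\pi$.
   Context: $G:=\mathbb{Q}\pi$; for nonzero $g\in G$, $\operatorname{den}(g)$ is the denominator of $g/\pi$ in lowest terms. *)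

theory Defs
  imports Complex_Main "HOL-Computational_Algebra.Primes" "HOL-Combinatorics.Permutations"
begin

definition G :: "real set" where
  "G = {of_rat q * pi | q. True}"

text \<open>
  \<^const>\<open>quotient_of\<close> yields the coprime numerator/denominator pair with positive denominator.
  Since \<open>of_rat\<close> is injective, the description is uniquely satisfied for every element of
  \<open>G\<close>; outside \<open>G\<close> the value is meaningless.
\<close>

definition den :: "real \<Rightarrow> int" where
  "den g = snd (quotient_of (THE q. of_rat q = g / pi))"

end

theory Submission
  imports Defs "HOL-Number_Theory.Residues" "HOL-Computational_Algebra.Computational_Algebra"
begin

text \<open>
  Put \<open>z\<^sub>i = cis (2 x\<^sub>i)\<close>, a primitive \<open>n\<close>-th root of unity. Since
  \<open>z - 1 = \<i> tan x (z + 1)\<close>, the hypothesis says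
  \<open>(1 + z\<^sub>0\<^sup>2) S = 2 z\<^sub>0 D\<close>, where \<open>S = 1 + e\<^sub>2 + e\<^sub>4\<close> and
  \<open>D = e\<^sub>1 + e\<^sub>3\<close> are built from the elementary symmetric functions of
  \<open>z\<^sub>1, \<dots>, z\<^sub>4\<close>. As \<open>8\<close> divides \<open>n\<close>, \<open>1 + z\<^sub>0\<^sup>2\<close> divides the sum of any two odd
  powers of \<open>z\<^sub>0\<close>, hence \<open>D\<close>; so \<open>S\<close>, a sum of eight roots of unity, lies in
  \<open>2 \<int>[z\<^sub>0]\<close>. Because every odd prime factor of \<open>n\<close> is at least \<open>7\<close>, eight roots of unity
  whose sum vanishes modulo \<open>2\<close> must cancel in pairs up to sign. For the terms
  \<open>1, z\<^sub>1z\<^sub>2z\<^sub>3z\<^sub>4, z\<^sub>iz\<^sub>j\<close> of \<open>S\<close> this forces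
  \<open>z\<^sub>iz\<^sub>j = -1\<close>, i.e. \<open>x\<^sub>i + x\<^sub>j = \<pi>/2\<close>, for some \<open>i \<noteq> j\<close>. What remains is
  \<open>tan\<^sup>2 x\<^sub>0 = tan x\<^sub>k tan x\<^sub>l\<close>, and the same argument makes \<open>z\<^sub>k + z\<^sub>l\<close> vanish
  modulo \<open>2\<close>, so \<open>x\<^sub>k = x\<^sub>l = x\<^sub>0\<close>.
\<close>

subsection \<open>Conjugates of roots of unity\<close>

text \<open>Elements of the ring Z[z] are written as values \<open>ipoly f z\<close>, so "zero
  modulo 2 in Z[z]" reads \<open>... = 2 * ipoly b z\<close>.\<close>

abbreviation ipoly :: "int poly \<Rightarrow> complex \<Rightarrow> complex" where
  "ipoly f z \<equiv> poly (map_poly of_int f) z"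

lemma ipoly_pCons [simp]: "ipoly (pCons a f) z = of_int a + z * ipoly f z"
  by (simp add: map_poly_pCons)

lemma ipoly_add [simp]: "ipoly (f + g) z = ipoly f z + ipoly g z"
  by (induction f g rule: poly_induct2) (simp_all add: algebra_simps)

lemma ipoly_smult [simp]: "ipoly (smult a f) z = of_int a * ipoly f z"
  by (induction f) (simp_all add: algebra_simps)

lemma ipoly_uminus [simp]: "ipoly (- f) z = - ipoly f z"
  using ipoly_smult[of "-1" f z] by simp

lemma ipoly_diff [simp]: "ipoly (f - g) z = ipoly f z - ipoly g z"
  using ipoly_add[of f "- g" z] by simp

lemma ipoly_mult [simp]: "ipoly (f * g) z = ipoly f z * ipoly g z"
  by (induction f) (simp_all add: algebra_simps)

lemma ipoly_1 [simp]: "ipoly 1 z = 1"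
  by (simp add: one_pCons)

lemma ipoly_monom [simp]: "ipoly (monom a k) z = of_int a * z ^ k"
  by (induction k) (simp_all add: monom_Suc monom_0)

lemma ipoly_power [simp]: "ipoly (f ^ k) z = ipoly f z ^ k"
  by (induction k) simp_all

lemma ipoly_sum [simp]: "ipoly (sum f A) z = (\<Sum>i\<in>A. ipoly (f i) z)"
  by (induction A rule: infinite_finite_induct) simp_all

lemma ipoly_altdef: "ipoly f z = (\<Sum>i\<le>degree f. of_int (coeff f i) * z ^ i)"
proof -
  have "ipoly f z = ipoly (\<Sum>i\<le>degree f. monom (coeff f i) i) z"
    by (simp only: poly_as_sum_of_monoms)
  then show ?thesis
    by simp
qed

section \<open>Minimal polynomials over the integers and reduction modulo a prime\<close>

text \<open>A nonzero integer polynomial of least degree vanishing at \<open>z\<close>, made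
  primitive, divides all others by pseudo-division and Gauss's lemma. Since it divides the monic
  \<open>X ^ n - 1\<close>, its leading coefficient is a unit.\<close>

lemma min_poly_root_of_unity:
  fixes z :: complex
  assumes "z ^ n = 1" "n > 0"
  obtains M :: "int poly" where "ipoly M z = 0" "is_unit (lead_coeff M)" "degree M > 0"
    "\<And>f. ipoly f z = 0 \<Longrightarrow> M dvd f"
proof -
  define X where "X = (monom 1 n - 1 :: int poly)"
  have X: "ipoly X z = 0" "lead_coeff X = 1" "X \<noteq> 0"
  proof -
    show "ipoly X z = 0"
      using assms by (simp add: X_def)
    have "degree X = n"
      unfolding X_def using assms(2) degree_add_eq_left[of "- 1" "monom 1 n :: int poly"]
      by (simp add: degree_monom_eq)
    then show "lead_coeff X = 1"
      using assms(2) by (simp add: X_def)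
    then show "X \<noteq> 0"
      by auto
  qed
  obtain F where F: "F \<noteq> 0" "ipoly F z = 0"
    and min: "\<And>f. f \<noteq> 0 \<Longrightarrow> ipoly f z = 0 \<Longrightarrow> degree F \<le> degree f"
    using ex_has_least_nat[of "\<lambda>f. f \<noteq> 0 \<and> ipoly f z = 0" X degree] X by blast
  define M where "M = primitive_part F"
  have M_smult: "smult (content F) M = F"
    by (simp add: M_def)
  have cF: "content F \<noteq> 0"
    using F by simp
  have M0: "ipoly M z = 0"
    using F(2) cF ipoly_smult[of "content F" M z] unfolding M_smult by simp
  have M_nz: "M \<noteq> 0"
    using M_smult F by auto
  have degM: "degree M = degree F"
    using M_smult cF by (metis degree_smult_eq)
  have cM: "content M = 1"
    using F by (simp add: M_def)
  have dvd: "M dvd f" if f: "ipoly f z = 0" for f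
  proof -
    obtain a q where aq: "a \<noteq> 0" "smult a f = M * q + pseudo_mod f M"
      using pseudo_mod(1)[OF M_nz] by blast
    have "ipoly (pseudo_mod f M) z = ipoly (smult a f - M * q) z"
      using aq by simp
    also have "\<dots> = 0"
      using f M0 by simp
    finally have "pseudo_mod f M = 0"
      using pseudo_mod(2)[OF M_nz, of f] min[of "pseudo_mod f M"] degM by fastforce
    then have eq: "smult a f = M * q"
      using aq by simp
    \<comment> \<open>Contents are multiplicative and \<open>M\<close> is primitive, so the factor
      \<open>a\<close> introduced by pseudo-division sits inside \<open>q\<close> and
      cancels.\<close>
    then have "\<bar>a\<bar> * content f = content q"
      by (metis cM content_mult content_smult mult_1 normalize_int_def)
    then have "a dvd content q"
      by (metis dvd_abs_iff dvd_triv_left abs_dvd_iff)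
    then obtain q' where "q = smult a q'"
      unfolding const_poly_dvd_iff_dvd_content[symmetric] by (auto elim: dvdE)
    then have "smult a f = smult a (M * q')"
      using eq by simp
    then have "f = M * q'"
      using aq(1) by (metis smult_cancel)
    then show ?thesis
      by simp
  qed
  have unit: "is_unit (lead_coeff M)"
    using dvd[OF X(1)] X(2) by (metis dvdE dvd_triv_left lead_coeff_mult)
  have "degree M > 0"
  proof (rule ccontr)
    assume "\<not> degree M > 0"
    then obtain c where c: "M = [:c:]"
      by (auto elim: degree_eq_zeroE)
    then show False
      using M0 M_nz by simp
  qed
  with M0 unit dvd show ?thesis
    using that by blast
qed

text \<open>Modulo \<open>p\<close> the polynomial \<open>M\<close> keeps its positive degree, so a
  multiple of it is constant only if it vanishes. Consequently an integer in \<open>p\<close> Z[z]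
  is a multiple of \<open>p\<close>. The induction strips the leading terms of \<open>q\<close>,
  each divisible by \<open>p\<close>.\<close>

lemma const_dvd_of_dvd_mult_add:
  fixes M q :: "int poly"
  assumes M: "is_unit (lead_coeff M)" "degree M > 0"
    and "[:p:] dvd M * q + [:c:]"
  shows "p dvd c"
  using assms(3)
\<comment> \<open>The measure separates \<open>q = 0\<close> from nonzero constants, which have
  degree 0 as well.\<close>
proof (induction "if q = 0 then 0 else Suc (degree q)" arbitrary: q rule: less_induct)
  case less
  show ?case
  proof (cases "q = 0")
    case True
    then show ?thesis
      using less.prems by simp
  next
    case False
    have M0: "M \<noteq> 0"
      using M by auto
    have "p dvd coeff (M * q + [:c:]) (degree M + degree q)"
      using less.prems const_poly_dvd_iff by blast
    then have "p dvd lead_coeff M * lead_coeff q"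
      using M(2) by (simp add: coeff_mult_degree_sum coeff_pCons split: nat.splits)
    then have p: "p dvd lead_coeff q"
      using M(1) by (simp add: dvd_mult_unit_iff')
    define q' where "q' = q - monom (lead_coeff q) (degree q)"
    have "[:p:] dvd monom (lead_coeff q) (degree q)"
      using p by (auto simp: const_poly_dvd_iff coeff_monom)
    then have "[:p:] dvd M * q + [:c:] - M * monom (lead_coeff q) (degree q)"
      using less.prems by (metis dvd_diff dvd_mult)
    moreover have "M * q + [:c:] - M * monom (lead_coeff q) (degree q) = M * q' + [:c:]"
      by (simp add: q'_def algebra_simps)
    ultimately have dv: "[:p:] dvd M * q' + [:c:]"
      by simp
    have "degree q' < degree q" if "q' \<noteq> 0"
    proof -
      have "degree q' \<le> degree q"
        unfolding q'_def by (intro degree_diff_le) (auto simp: degree_monom_le)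
      moreover have "coeff q' (degree q) = 0"
        by (simp add: q'_def)
      ultimately show ?thesis
        using that by (metis leading_coeff_0_iff le_neq_implies_less)
    qed
    then show ?thesis
      using less.hyps[OF _ dv] False by auto
  qed
qed

text \<open>This is the congruence of \<open>f (X ^ p)\<close> and \<open>f (X) ^ p\<close> modulo
  \<open>p\<close>, evaluated at \<open>z\<close>: the inner binomial coefficients vanish modulo
  \<open>p\<close>, and Fermat handles the coefficients of \<open>f\<close>.\<close>

lemma ipoly_frobenius:
  assumes "prime p"
  shows "\<exists>g. ipoly f (z ^ p) = ipoly f z ^ p + of_nat p * ipoly g z"
proof (induction f)
  case 0
  show ?case
    using prime_gt_0_nat[OF assms] by (intro exI[of _ 0]) simp
next
  case (pCons a f)
  obtain g where g: "ipoly f (z ^ p) = ipoly f z ^ p + of_nat p * ipoly g z"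
    using pCons.IH by blast
  define F where "F = pCons 0 f"
  \<comment> \<open>\<open>H\<close> collects the inner terms of the expansion of
    \<open>([:a:] + F) ^ p\<close>, with the factor \<open>p\<close> of each binomial coefficient
    removed.\<close>
  define H where "H = (\<Sum>k\<in>{1..<p}. smult (int ((p choose k) div p)) ([:a:] ^ k * F ^ (p - k)))"
  have p: "p > 1"
    using prime_gt_1_nat[OF assms] .
  have "[int (nat (a mod int p)) ^ p = int (nat (a mod int p))] (mod int p)"
  proof -
    have "[nat (a mod int p) ^ p = nat (a mod int p)] (mod p)"
    proof (cases "p dvd nat (a mod int p)")
      case True
      then show ?thesis
        using p by (metis cong_0_iff cong_sym cong_trans dvd_power_iff_le dvd_trans dvd_power prime_gt_0_nat assms)
    next
      case False
      then have "[nat (a mod int p) ^ (p - 1) = 1] (mod p)"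
        using assms fermat_theorem by blast
      then have "[nat (a mod int p) * nat (a mod int p) ^ (p - 1) = nat (a mod int p) * 1] (mod p)"
        using cong_mult cong_refl by blast
      then show ?thesis
        using p by (metis Suc_pred' mult_1_right power_Suc prime_gt_0_nat assms)
    qed
    then show ?thesis
      by (metis cong_int_iff of_nat_power)
  qed
  then have "[(a mod int p) ^ p = a mod int p] (mod int p)"
    using p by simp
  then have "[a ^ p = a] (mod int p)"
    by (simp add: cong_def power_mod)
  then obtain b where b: "a = a ^ p + int p * b"
    using cong_iff_lin by blast
  have "ipoly ([:a:] + F) z ^ p = (\<Sum>k\<le>p. of_nat (p choose k) * of_int a ^ k * ipoly F z ^ (p - k))"
    by (simp add: binomial_ring)
  also have "{..p} = insert 0 (insert p {1..<p})"
    using p by auto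
  also have "(\<Sum>k\<in>\<dots>. of_nat (p choose k) * of_int a ^ k * ipoly F z ^ (p - k)) =
      ipoly F z ^ p + of_int a ^ p + (\<Sum>k\<in>{1..<p}. of_nat (p choose k) * of_int a ^ k * ipoly F z ^ (p - k))"
    using p by simp
  also have "(\<Sum>k\<in>{1..<p}. of_nat (p choose k) * of_int a ^ k * ipoly F z ^ (p - k)) = of_nat p * ipoly H z"
  proof -
    have *: "of_nat (p choose k) = (of_nat p * of_nat ((p choose k) div p) :: complex)" if "k \<in> {1..<p}" for k
    proof -
      have "p dvd (p choose k)"
        using that assms by (intro dvd_choose_prime) auto
      then show ?thesis
        by (metis dvd_mult_div_cancel of_nat_mult)
    qed
    show ?thesis
      unfolding H_def by (simp add: sum_distrib_left * mult.assoc)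
  qed
  finally have 1: "ipoly ([:a:] + F) z ^ p = ipoly F z ^ p + of_int a ^ p + of_nat p * ipoly H z" .
  have 2: "of_int a = (of_int a ^ p + of_nat p * of_int b :: complex)"
    using arg_cong[OF b, of "of_int :: int \<Rightarrow> complex"] by simp
  \<comment> \<open>\<open>b\<close> accounts for replacing \<open>a\<close> by
    \<open>a ^ p\<close>, \<open>monom 1 p * g\<close> for the induction hypothesis times
    \<open>z ^ p\<close>, and \<open>- H\<close> for the inner binomial terms.\<close>
  have "ipoly (pCons a f) (z ^ p) = ipoly (pCons a f) z ^ p + of_nat p * ipoly ([:b:] + monom 1 p * g - H) z"
  proof -
    have "ipoly (pCons a f) z = ipoly ([:a:] + F) z"
      by (simp add: F_def)
    moreover have "ipoly F z = z * ipoly f z"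
      by (simp add: F_def)
    ultimately show ?thesis
      using 1 2 g by (simp add: algebra_simps power_mult_distrib)
  qed
  then show ?case
    by blast
qed

text \<open>
  If \<open>z ^ p\<close> were not a root of the minimal polynomial \<open>M\<close> of \<open>z\<close>, it would be a root of the
  cofactor \<open>h\<close> of \<open>M\<close> in \<open>X ^ n - 1\<close>; differentiating, \<open>M (z ^ p)\<close> would divide \<open>n\<close>, whereas
  Frobenius makes it a multiple of \<open>p\<close>.
\<close>

lemma ipoly_root_power_prime:
  fixes z :: complex
  assumes z: "z ^ n = 1" "n > 0" and p: "prime p" "\<not> p dvd n" and f: "ipoly f z = 0"
  shows "ipoly f (z ^ p) = 0"
proof -
  obtain M where M: "ipoly M z = 0" "is_unit (lead_coeff M)" "degree M > 0"
    "\<And>f. ipoly f z = 0 \<Longrightarrow> M dvd f"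
    using min_poly_root_of_unity[OF z] by blast
  have "ipoly (monom 1 n - 1) z = 0"
    using z by simp
  then obtain h where h: "monom 1 n - 1 = M * h"
    using M(4) by (metis dvdE)
  have "ipoly M (z ^ p) = 0"
  proof (rule ccontr)
    assume nz: "ipoly M (z ^ p) \<noteq> 0"
    have zp: "(z ^ p) ^ n = 1"
      using z by (metis mult.commute power_mult power_one)
    have "ipoly (M * h) (z ^ p) = 0"
      using zp by (simp flip: h)
    with nz have hz: "ipoly h (z ^ p) = 0"
      by simp
    have "pderiv (monom 1 n - 1) = M * pderiv h + h * pderiv M"
      by (simp add: h pderiv_mult)
    then have "ipoly (monom (int n) (n - 1)) (z ^ p) = ipoly (M * pderiv h + h * pderiv M) (z ^ p)"
      by (simp add: pderiv_diff pderiv_monom)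
    then have 1: "of_nat n * (z ^ p) ^ (n - 1) = ipoly M (z ^ p) * ipoly (pderiv h) (z ^ p)"
      using hz by simp
    have 2: "of_nat n = z ^ p * ipoly M (z ^ p) * ipoly (pderiv h) (z ^ p)"
    proof -
      have "z ^ p * (z ^ p) ^ (n - 1) = 1"
        using zp z(2) by (metis Suc_pred' power_Suc)
      then show ?thesis
        using 1 by (metis (no_types, lifting) mult.assoc mult.commute mult_1_right)
    qed
    obtain g where g: "ipoly M (z ^ p) = of_nat p * ipoly g z"
      using ipoly_frobenius[OF p(1), of M z] M(1) prime_gt_0_nat[OF p(1)]
      by (auto simp: zero_power)
    \<comment> \<open>Composition with \<open>monom 1 p\<close> rewrites a value at
      \<open>z ^ p\<close> as a value at \<open>z\<close>; thus \<open>n\<close> becomes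
      \<open>p\<close> times \<open>ipoly K z\<close>.\<close>
    define K where "K = monom 1 p * g * pcompose (pderiv h) (monom 1 p)"
    have comp: "ipoly (pcompose q (monom 1 p)) z = ipoly q (z ^ p)" for q
      by (induction q) (simp_all add: pcompose_pCons)
    have "ipoly (smult (int p) K - [:int n:]) z = 0"
      using 2 g by (simp add: K_def comp algebra_simps)
    then obtain q where "smult (int p) K - [:int n:] = M * q"
      using M(4) by (metis dvdE)
    then have "M * q + [:int n:] = [:int p:] * K"
      by (simp add: algebra_simps)
    then have "int p dvd int n"
      using const_dvd_of_dvd_mult_add[OF M(2,3)] by (metis dvd_triv_left)
    then show False
      using p by simp
  qed
  with M(4)[OF f] show ?thesis
    by (auto elim: dvdE)
qed

text \<open>The exponent is built up prime by prime; \<open>z\<close> is generalised because each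
  prime replaces it by \<open>z ^ p\<close>, again an \<open>n\<close>-th root of unity.\<close>

lemma ipoly_root_power_coprime:
  fixes z :: complex
  assumes "z ^ n = 1" "n > 0" "coprime k n" "k > 0" "ipoly f z = 0"
  shows "ipoly f (z ^ k) = 0"
  using assms
proof (induction k arbitrary: z rule: prime_divisors_induct)
  case (factor p k)
  then have p: "\<not> p dvd n" "coprime k n" "k > 0"
    by (auto simp: coprime_absorb_left)
  have "(z ^ p) ^ n = 1"
    using factor.prems(1) by (metis mult.commute power_mult power_one)
  moreover have "ipoly f (z ^ p) = 0"
    using ipoly_root_power_prime factor p by blast
  ultimately have "ipoly f ((z ^ p) ^ k) = 0"
    using factor.IH p factor.prems(2) by blast
  then show ?case
    by (simp add: power_mult)
qed auto

subsection \<open>Splitting relations by residues of exponents\<close>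

definition primitive_root :: "nat \<Rightarrow> complex \<Rightarrow> bool" where
  "primitive_root n z \<longleftrightarrow> n > 0 \<and> (\<forall>k. z ^ k = 1 \<longleftrightarrow> n dvd k)"

lemma primitive_root_power_dvd:
  assumes "primitive_root n z" "p dvd n"
  shows "primitive_root (n div p) (z ^ p)"
  using assms
  by (auto simp: primitive_root_def dvd_div_iff_mult dvd_def div_greater_zero_iff
      simp flip: power_mult intro!: Nat.gr0I)

lemma primitive_root_nonzero: "primitive_root n z \<Longrightarrow> z \<noteq> 0"
  unfolding primitive_root_def by (metis dvd_refl power_0_left zero_neq_one less_irrefl)

lemma power_one_plus_mult: "z ^ (1 + j * m) = z * (z ^ m) ^ j" for z :: "'a :: comm_monoid_mult"
  by (metis mult.commute power_mult power_Suc plus_1_eq_Suc)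

lemma coprime_one_plus_mult: "coprime (1 + j * m) m" for j m :: nat
  by (rule coprimeI) (metis add.commute dvd_add_right_iff dvd_mult)

text \<open>These are the eigencomponents of \<open>f\<close> under \<open>z\<close> to
  \<open>z * w\<close> with \<open>w ^ p = 1\<close>, the eigenvalue being
  \<open>w ^ a\<close>.\<close>

definition residue_part :: "nat \<Rightarrow> nat \<Rightarrow> int poly \<Rightarrow> int poly" where
  "residue_part p a f = (\<Sum>j\<le>degree f. if j mod p = a then monom (coeff f j) j else 0)"

lemma coeff_residue_part [simp]:
  "coeff (residue_part p a f) j = (if j mod p = a then coeff f j else 0)"
proof -
  have "coeff (residue_part p a f) j =
      (\<Sum>i\<le>degree f. if i = j then (if j mod p = a then coeff f j else 0) else 0)"
    unfolding residue_part_def coeff_sum by (intro sum.cong) auto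
  also have "\<dots> = (if j mod p = a then coeff f j else 0)"
    by (auto simp: coeff_eq_0)
  finally show ?thesis .
qed

lemma residue_part_diff: "residue_part p a (f - g) = residue_part p a f - residue_part p a g"
  by (rule poly_eqI) simp

lemma residue_part_smult: "residue_part p a (smult c f) = smult c (residue_part p a f)"
  by (rule poly_eqI) simp

lemma residue_part_sum_monom:
  assumes "finite I"
  shows "residue_part p a (\<Sum>i\<in>I. monom 1 (e i)) = (\<Sum>i\<in>{i \<in> I. e i mod p = a}. monom 1 (e i))"
proof (rule poly_eqI)
  fix j
  have "(\<Sum>i\<in>{i \<in> I. e i mod p = a}. coeff (monom (1 :: int) (e i)) j) =
      (\<Sum>i\<in>I. if e i mod p = a then coeff (monom 1 (e i)) j else 0)"
    by (rule sum.inter_filter[OF assms])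
  also have "\<dots> = coeff (residue_part p a (\<Sum>i\<in>I. monom 1 (e i))) j"
    unfolding coeff_residue_part coeff_sum
    by (auto intro!: sum.cong sum.neutral simp: coeff_monom)
  finally show "coeff (residue_part p a (\<Sum>i\<in>I. monom 1 (e i))) j =
      coeff (\<Sum>i\<in>{i \<in> I. e i mod p = a}. monom 1 (e i)) j"
    by (simp add: coeff_sum)
qed

lemma sum_residue_part: "p > 0 \<Longrightarrow> (\<Sum>a<p. residue_part p a f) = f"
  by (rule poly_eqI) (simp add: coeff_sum)

lemma ipoly_residue_part_mult:
  assumes "w ^ p = 1"
  shows "ipoly (residue_part p a f) (z * w) = w ^ a * ipoly (residue_part p a f) z"
  unfolding ipoly_altdef sum_distrib_left
proof (intro sum.cong refl)
  fix i
  have "w ^ i = w ^ (i mod p)"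
  proof -
    have "w ^ i = w ^ (p * (i div p) + i mod p)"
      by simp
    also have "\<dots> = w ^ (i mod p)"
      using assms by (simp only: power_add power_mult power_one mult_1)
    finally show ?thesis .
  qed
  then show "of_int (coeff (residue_part p a f) i) * (z * w) ^ i =
      w ^ a * (of_int (coeff (residue_part p a f) i) * z ^ i)"
    by (simp add: power_mult_distrib)
qed

text \<open>Dividing out \<open>z ^ a\<close> turns a relation inside one residue class into a
  relation over Z[z^p].\<close>

lemma ipoly_residue_part_power:
  "\<exists>g. ipoly (residue_part p a f) z = z ^ a * ipoly g (z ^ p)"
proof -
  have "ipoly (residue_part p a f) z =
      (\<Sum>j\<le>degree f. if j mod p = a then of_int (coeff f j) * z ^ j else 0)"
    unfolding residue_part_def by (simp add: if_distrib[of "\<lambda>f. ipoly f z"] cong: if_cong)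
  also have "\<dots> = z ^ a * ipoly (\<Sum>j\<le>degree f. if j mod p = a then monom (coeff f j) (j div p) else 0) (z ^ p)"
    by (auto simp: sum_distrib_left if_distrib[of "\<lambda>f. ipoly f _"] simp flip: power_mult power_add
        intro!: sum.cong cong: if_cong)
  finally show ?thesis
    by blast
qed

lemma sum_powers_root_of_unity:
  fixes w :: complex
  assumes "w ^ p = 1" "w \<noteq> 1"
  shows "(\<Sum>j<p. w ^ j) = 0"
  using assms by (simp add: geometric_sum)

text \<open>Discrete Fourier inversion: \<open>w ^ (j * (p - a))\<close> stands for the inverse of
  \<open>w ^ (j * a)\<close>, and the sums over \<open>j\<close> are orthogonality
  relations.\<close>

lemma residue_part_inversion:
  assumes w: "primitive_root p w" and a: "a < p"
  shows "(\<Sum>j<p. w ^ (j * (p - a)) * ipoly f (z * w ^ j)) = of_nat p * ipoly (residue_part p a f) z"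
proof -
  have wp: "w ^ p = 1"
    using w by (auto simp: primitive_root_def)
  have p: "p > 0"
    using a by simp
  have "ipoly f (z * w ^ j) = (\<Sum>b<p. (w ^ j) ^ b * ipoly (residue_part p b f) z)" for j
  proof -
    have "(w ^ j) ^ p = 1"
      using wp by (metis mult.commute power_mult power_one)
    then show ?thesis
      by (subst (1) sum_residue_part[OF p, symmetric]) (simp add: ipoly_residue_part_mult)
  qed
  moreover have *: "w ^ (j * (p - a)) * (w ^ j) ^ b = (w ^ (p - a + b)) ^ j" for j b
    by (simp only: power_mult[symmetric] power_add[symmetric] add_mult_distrib mult.commute[of j])
  ultimately have "(\<Sum>j<p. w ^ (j * (p - a)) * ipoly f (z * w ^ j)) =
      (\<Sum>j<p. \<Sum>b<p. (w ^ (p - a + b)) ^ j * ipoly (residue_part p b f) z)"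
    using * by (simp add: sum_distrib_left flip: mult.assoc)
  also have "\<dots> = (\<Sum>b<p. (\<Sum>j<p. (w ^ (p - a + b)) ^ j) * ipoly (residue_part p b f) z)"
    by (subst sum.swap) (simp add: sum_distrib_right)
  also have "\<dots> = (\<Sum>b<p. if b = a then of_nat p * ipoly (residue_part p a f) z else 0)"
  proof (intro sum.cong refl)
    fix b assume b: "b \<in> {..<p}"
    have "(\<Sum>j<p. (w ^ (p - a + b)) ^ j) = (if b = a then of_nat p else 0)"
    proof (cases "b = a")
      case True
      then show ?thesis
        using a wp by simp
    next
      case False
      \<comment> \<open>This number lies strictly between 0 and \<open>2 * p\<close>, so it could
        only be \<open>p\<close> itself, which means \<open>b = a\<close>.\<close>
      have "\<not> p dvd p - a + b"
      proof
        assume "p dvd p - a + b"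
        then obtain c where c: "p - a + b = p * c"
          by (auto elim: dvdE)
        have "c < 2"
        proof (rule ccontr)
          assume "\<not> c < 2"
          then have "p * 2 \<le> p * c"
            by simp
          then show False
            using c b a unfolding lessThan_iff by linarith
        qed
        then have "c = 0 \<or> c = 1"
          by auto
        then show False
          using c b a False by auto
      qed
      then have "w ^ (p - a + b) \<noteq> 1"
        using w by (simp add: primitive_root_def)
      moreover have "(w ^ (p - a + b)) ^ p = 1"
        using wp by (metis mult.commute power_mult power_one)
      ultimately show ?thesis
        using sum_powers_root_of_unity False by simp
    qed
    then show "(\<Sum>j<p. (w ^ (p - a + b)) ^ j) * ipoly (residue_part p b f) z =
        (if b = a then of_nat p * ipoly (residue_part p a f) z else 0)"
      by simp
  qed
  also have "\<dots> = of_nat p * ipoly (residue_part p a f) z"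
    using a by simp
  finally show ?thesis .
qed

text \<open>As \<open>p\<close> divides \<open>n div p\<close>, every exponent
  \<open>1 + j * (n div p)\<close> is coprime to \<open>n\<close>. Hence all points in the Fourier
  inversion are conjugates of \<open>z\<close> and roots of \<open>f\<close>.\<close>

lemma residue_part_root_square:
  assumes z: "primitive_root n z" and p: "prime p" "p ^ 2 dvd n" and f: "ipoly f z = 0" and a: "a < p"
  shows "ipoly (residue_part p a f) z = 0"
proof -
  define m where "m = n div p"
  have pn: "p dvd n"
    using p(2) unfolding power2_eq_square by (rule dvd_mult_left)
  then have n: "n = m * p"
    by (simp add: m_def)
  have pm: "p dvd m"
    using p unfolding n power2_eq_square by (simp add: prime_gt_0_nat)
  have w: "primitive_root p (z ^ m)"
    using primitive_root_power_dvd[OF z, of m] z n by (simp add: primitive_root_def)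
  have "ipoly f (z * (z ^ m) ^ j) = 0" for j
  proof -
    have "coprime (1 + j * m) m"
      by (rule coprime_one_plus_mult)
    moreover from this have "coprime (1 + j * m) p"
      using pm by (meson coprime_divisors dvd_refl)
    ultimately have "coprime (1 + j * m) n"
      by (simp add: n)
    then have "ipoly f (z ^ (1 + j * m)) = 0"
      using z f by (intro ipoly_root_power_coprime[of _ n]) (auto simp: primitive_root_def)
    then show ?thesis
      by (simp only: power_one_plus_mult)
  qed
  then have "of_nat p * ipoly (residue_part p a f) z = 0"
    unfolding residue_part_inversion[OF w a, symmetric] by simp
  then show ?thesis
    using prime_gt_0_nat[OF p(1)] by simp
qed

text \<open>
  Here \<open>y = z ^ k\<close> with \<open>k \<equiv> 1\<close> modulo \<open>n div p\<close> and \<open>p dvd k\<close>: the one exponent of this kind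
  that is not coprime to \<open>n\<close>, so that \<open>y\<close> need not be a root of \<open>f\<close>.
\<close>

lemma residue_part_root_simple:
  assumes z: "primitive_root n z" and p: "prime p" "p dvd n" "\<not> p ^ 2 dvd n"
  obtains w y where "primitive_root (n div p) y" "y = z * w" "w ^ p = 1"
    "\<And>f a. ipoly f z = 0 \<Longrightarrow> a < p \<Longrightarrow> of_nat p * ipoly (residue_part p a f) y = ipoly f y"
proof -
  define m where "m = n div p"
  have n: "n = m * p"
    using p by (simp add: m_def)
  have m: "m > 0"
    using z n by (simp add: primitive_root_def)
  have p0: "p > 0"
    using prime_gt_0_nat[OF p(1)] .
  have pm: "\<not> p dvd m"
    using p unfolding n power2_eq_square by (simp add: p0)
  have w: "primitive_root p (z ^ m)"
    using primitive_root_power_dvd[OF z, of m] z n by (simp add: primitive_root_def)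
  define w where "w = z ^ m"
  have w: "primitive_root p w"
    using w by (simp add: w_def)
  then have wp: "w ^ p = 1"
    by (simp add: primitive_root_def)
  have cop: "coprime m p"
    using p(1) pm by (metis coprime_commute prime_imp_coprime)
  obtain i where i: "[m * i = 1] (mod p)"
    using cong_solve_coprime_nat[OF cop] by auto
  \<comment> \<open>\<open>i\<close> inverts \<open>m\<close> modulo \<open>p\<close> and
    \<open>p - 1\<close> acts as -1, so \<open>p\<close> divides \<open>1 + j0 * m\<close>.\<close>
  define j0 where "j0 = (i * (p - 1)) mod p"
  have j0: "j0 < p"
    using p0 by (simp add: j0_def)
  have "[1 + m * j0 = 1 + 1 * (p - 1)] (mod p)"
  proof -
    have "[m * j0 = m * (i * (p - 1))] (mod p)"
      unfolding j0_def by (intro cong_scalar_left) simp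
    also have "[m * (i * (p - 1)) = 1 * (p - 1)] (mod p)"
      unfolding mult.assoc[symmetric] by (intro cong_scalar_right i)
    finally show ?thesis
      by (intro cong_add) auto
  qed
  then have "p dvd 1 + m * j0"
    using p0 by (simp add: cong_def mod_eq_0_iff_dvd[symmetric])
  then have pk: "p dvd 1 + j0 * m"
    by (simp add: mult.commute)
  have copm: "coprime (1 + j * m) m" for j
    by (rule coprime_one_plus_mult)
  define y where "y = z * w ^ j0"
  have y: "y = z ^ (1 + j0 * m)"
    by (simp only: y_def w_def power_one_plus_mult)
  have "primitive_root m y"
    unfolding primitive_root_def
  proof (intro conjI allI)
    fix k
    obtain k1 where k1: "1 + j0 * m = p * k1"
      using pk by (auto elim: dvdE)
    have "coprime m k1"
      using copm[of j0] unfolding k1 by (simp add: coprime_commute)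
    have "y ^ k = 1 \<longleftrightarrow> n dvd (p * k1) * k"
      using z unfolding y k1 by (simp add: primitive_root_def flip: power_mult)
    also have "\<dots> \<longleftrightarrow> m dvd k1 * k"
      using p0 by (simp add: n mult.commute[of m] mult.assoc)
    also have "\<dots> \<longleftrightarrow> m dvd k"
      using \<open>coprime m k1\<close> by (simp add: coprime_dvd_mult_right_iff)
    finally show "y ^ k = 1 \<longleftrightarrow> m dvd k" .
  qed (use m in auto)
  moreover have "y = z * w ^ j0" "(w ^ j0) ^ p = 1"
    using wp by (auto simp: y_def) (metis mult.commute power_mult power_one)
  moreover have "of_nat p * ipoly (residue_part p a f) y = ipoly f y"
    if f: "ipoly f z = 0" and a: "a < p" for f a
  proof -
    \<comment> \<open>Since \<open>m\<close> is invertible modulo \<open>p\<close>, only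
      \<open>j0\<close> makes \<open>1 + j * m\<close> divisible by \<open>p\<close>. All other
      points are conjugates of \<open>z\<close>, and one term of the inversion formula
      survives.\<close>
    have zero: "ipoly f (z * w ^ j) = 0" if j: "j < p" "j \<noteq> j0" for j
    proof -
      have "coprime (1 + j * m) p"
      proof (rule ccontr)
        assume "\<not> coprime (1 + j * m) p"
        then have "p dvd 1 + j * m"
          using prime_imp_coprime[OF p(1)] coprime_commute by blast
        then have "[1 + j * m = 1 + j0 * m] (mod p)"
          using pk unfolding cong_def by (simp only: dvd_eq_mod_eq_0)
        then have "[j * m = j0 * m] (mod p)"
          by (simp only: cong_add_lcancel_nat)
        then have "[j = j0] (mod p)"
          using cop by (simp add: cong_mult_rcancel_nat)
        then show False
          using j j0 by (simp add: cong_def)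
      qed
      then have "coprime (1 + j * m) n"
        using copm[of j] by (simp add: n)
      then have "ipoly f (z ^ (1 + j * m)) = 0"
        using z f by (intro ipoly_root_power_coprime[of _ n]) (auto simp: primitive_root_def)
      then show ?thesis
        by (simp only: w_def power_one_plus_mult)
    qed
    have "of_nat p * ipoly (residue_part p a f) z =
        (\<Sum>j<p. if j = j0 then w ^ (j0 * (p - a)) * ipoly f y else 0)"
      unfolding residue_part_inversion[OF w a, symmetric]
      by (intro sum.cong) (auto simp: zero y_def)
    also have "\<dots> = w ^ (j0 * (p - a)) * ipoly f y"
      using j0 by simp
    finally have *: "of_nat p * ipoly (residue_part p a f) z = w ^ (j0 * (p - a)) * ipoly f y" .
    \<comment> \<open>Moving from \<open>z\<close> to \<open>y\<close> contributes
      \<open>(w ^ j0) ^ a\<close>, which cancels the Fourier factor; the value no longer depends on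
      \<open>a\<close>.\<close>
    have "of_nat p * ipoly (residue_part p a f) y = (w ^ j0) ^ a * (of_nat p * ipoly (residue_part p a f) z)"
      unfolding y_def using \<open>(w ^ j0) ^ p = 1\<close> by (subst ipoly_residue_part_mult) auto
    also have "\<dots> = w ^ (j0 * a + j0 * (p - a)) * ipoly f y"
      unfolding * by (simp add: power_add power_mult)
    also have "j0 * a + j0 * (p - a) = p * j0"
      using a by (metis add_mult_distrib2 le_add_diff_inverse less_imp_le mult.commute)
    also have "w ^ (p * j0) = 1"
      using wp by (simp add: power_mult)
    finally show ?thesis
      by simp
  qed
  ultimately show ?thesis
    using that by (simp add: m_def)
qed

subsection \<open>Short sums of roots of unity that vanish modulo 2\<close>

lemma even_card_if_even_fibres:
  assumes "finite I" "\<And>u. even (card {i \<in> I. f i = u})"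
  shows "even (card I)"
proof -
  have "card I = (\<Sum>u\<in>f ` I. card {i \<in> I. f i = u})"
    using sum.image_gen[OF assms(1), of "\<lambda>_. 1 :: nat" f] by simp
  then show ?thesis
    using assms(2) by (simp add: dvd_sum)
qed

lemma card_eq_sum_residues:
  fixes e :: "'a \<Rightarrow> nat"
  assumes "finite I" "p > 0"
  shows "card I = (\<Sum>a<p. card {i \<in> I. e i mod p = a})"
proof -
  have "I = (\<Union>a\<in>{..<p}. {i \<in> I. e i mod p = a})"
    using assms by auto
  then have "card I = card (\<Union>a\<in>{..<p}. {i \<in> I. e i mod p = a})"
    by simp
  also have "\<dots> = (\<Sum>a<p. card {i \<in> I. e i mod p = a})"
    using assms by (intro card_UN_disjoint) auto
  finally show ?thesis .
qed

lemma residue_part_relation: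
  assumes "finite I"
  shows "ipoly (residue_part p a ((\<Sum>i\<in>I. monom 1 (e i)) - smult 2 b)) z =
    (\<Sum>i\<in>{i \<in> I. e i mod p = a}. z ^ e i) - 2 * ipoly (residue_part p a b) z"
  by (simp add: residue_part_diff residue_part_smult residue_part_sum_monom assms)

text \<open>
  A class of size \<open>7\<close> would leave a singleton class, whose only fibre is odd.
\<close>

lemma even_fibres_split:
  fixes e :: "'a \<Rightarrow> nat"
  assumes I: "finite I" "card I \<le> 8" "card I \<noteq> 7" and p: "p > 0"
    and fibres: "\<And>a u. a < p \<Longrightarrow> card {i \<in> I. e i mod p = a} \<noteq> 7 \<Longrightarrow>
      even (card {i \<in> {i \<in> I. e i mod p = a}. f i = u})"
  shows "even (card {i \<in> I. f i = u})"
proof -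
  have no7: "card {i \<in> I. e i mod p = a} \<noteq> 7" if a: "a < p" for a
  proof
    assume 7: "card {i \<in> I. e i mod p = a} = 7"
    define J where "J = {i \<in> I. e i mod p \<noteq> a}"
    have fin: "finite J"
      using I by (simp add: J_def)
    have "card ({i \<in> I. e i mod p = a} \<union> J) = 7 + card J"
      using I(1) fin by (subst card_Un_disjoint) (auto simp: J_def 7)
    also have "{i \<in> I. e i mod p = a} \<union> J = I"
      by (auto simp: J_def)
    finally have "card J = 1"
      using I(2,3) by linarith
    then obtain k where J: "J = {k}"
      by (auto simp: card_1_singleton_iff)
    have k: "k \<in> I" "e k mod p \<noteq> a" "\<And>i. i \<in> I \<Longrightarrow> e i mod p \<noteq> a \<Longrightarrow> i = k"
      using J unfolding J_def by blast+
    have eq: "{i \<in> I. e i mod p = e k mod p} = {k}"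
    proof (intro Set.set_eqI iffI)
      fix i assume "i \<in> {i \<in> I. e i mod p = e k mod p}"
      then have i: "i \<in> I" "e i mod p = e k mod p"
        by simp_all
      then have "e i mod p \<noteq> a"
        using k(2) by (simp only: not_False_eq_True)
      then show "i \<in> {k}"
        using k(3) i(1) by blast
    next
      fix i assume "i \<in> {k}"
      then show "i \<in> {i \<in> I. e i mod p = e k mod p}"
        using k(1) by simp
    qed
    have "even (card {i \<in> {i \<in> I. e i mod p = e k mod p}. f i = f k})"
      using p by (intro fibres) (simp_all add: eq)
    moreover have "{i \<in> {i \<in> I. e i mod p = e k mod p}. f i = f k} = {k}"
      unfolding eq by auto
    ultimately show False
      by simp
  qed
  have "card {i \<in> I. f i = u} = (\<Sum>a<p. card {i \<in> {i \<in> I. f i = u}. e i mod p = a})"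
    by (rule card_eq_sum_residues) (use I p in auto)
  also have "\<dots> = (\<Sum>a<p. card {i \<in> {i \<in> I. e i mod p = a}. f i = u})"
    by (intro sum.cong arg_cong[where f = card]) auto
  finally show ?thesis
    using fibres no7 by (metis (no_types, lifting) dvd_sum lessThan_iff)
qed

text \<open>
  Comparing squares identifies roots of unity that differ by a sign. The size \<open>7\<close> is excluded
  because of the seven \<open>7\<close>-th roots of unity.
\<close>

lemma even_fibres_of_vanishing_mod_2:
  fixes z :: complex and e :: "'a \<Rightarrow> nat"
  assumes "primitive_root n z" "\<forall>q. prime q \<longrightarrow> q dvd n \<longrightarrow> q = 2 \<or> q \<ge> 7"
    "finite I" "card I \<le> 8" "card I \<noteq> 7" "(\<Sum>i\<in>I. z ^ e i) = 2 * ipoly b z"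
  shows "even (card {i \<in> I. (z ^ e i)\<^sup>2 = u})"
  using assms
proof (induction n arbitrary: z I e b u rule: less_induct)
  case (less n)
  note z = less.prems(1) and primes = less.prems(2) and I = less.prems(3-5)
  define f where "f = (\<Sum>i\<in>I. monom 1 (e i)) - smult 2 b"
  have f: "ipoly f z = 0"
    using less.prems(6) by (simp add: f_def)
  have n0: "n > 0"
    using z by (simp add: primitive_root_def)
  \<comment> \<open>If 2 were the only prime factor and occurred once, \<open>n\<close> would divide
    2. So otherwise some prime occurs at least twice, or an odd one, at least 7, occurs exactly
    once.\<close>
  consider (square) p where "prime p" "p ^ 2 dvd n"
    | (simple) p where "prime p" "p \<ge> 7" "p dvd n" "\<not> p ^ 2 dvd n"
    | (trivial) "n dvd 2"
  proof (cases "n dvd 2")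
    case False
    have "\<exists>p. prime p \<and> p dvd n \<and> (p \<noteq> 2 \<or> p ^ 2 dvd n)"
    proof (rule ccontr)
      assume no: "\<not> ?thesis"
      from False obtain p where p: "prime p" "p dvd n"
        by (metis one_dvd prime_factor_nat)
      with no have p2: "p = 2" "\<not> 4 dvd n"
        by auto
      obtain m where m: "n = 2 * m"
        using p p2 by (auto elim: dvdE)
      have "m \<noteq> 1"
        using False m by auto
      then obtain q where q: "prime q" "q dvd m"
        using prime_factor_nat by blast
      then have "q dvd n"
        using m by simp
      with no q have "q = 2"
        by blast
      with q m p2 show False
        by auto
    qed
    then obtain p where p: "prime p" "p dvd n" "p \<noteq> 2 \<or> p ^ 2 dvd n"
      by blast
    then show ?thesis
      using primes that(1,2)[of p] by blast
  qed
  then show ?case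
  proof cases
    case trivial
    \<comment> \<open>Here \<open>z\<close> is 1 or -1: the relation is between integers, all
      summands are odd, and all squares are 1, so the only possible nonempty fibre is
      \<open>I\<close>.\<close>
    then have sq: "z ^ 2 = 1"
      using z by (simp add: primitive_root_def)
    then obtain s :: int where s: "z = of_int s" "odd s"
    proof -
      have "z = 1 \<or> z = - 1"
        using sq by (simp add: power2_eq_1_iff)
      then show ?thesis
        using that[of 1] that[of "- 1"] by auto
    qed
    have "ipoly b (of_int s) = of_int (poly b s)"
      by (induction b) simp_all
    then have "of_int (\<Sum>i\<in>I. s ^ e i) = (of_int (2 * poly b s) :: complex)"
      using less.prems(6) by (simp add: s)
    then have sum: "(\<Sum>i\<in>I. s ^ e i) = 2 * poly b s"
      unfolding of_int_eq_iff .
    have "even (\<Sum>i\<in>I. s ^ e i) \<longleftrightarrow> even (card I)"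
      using I(1) s(2) by (induction I rule: finite_induct) auto
    then have ev: "even (card I)"
      unfolding sum by simp
    have "(z ^ e i)\<^sup>2 = 1" for i
      using sq by (metis mult.commute power_mult power_one)
    then have "{i \<in> I. (z ^ e i)\<^sup>2 = u} = (if u = 1 then I else {})"
      by auto
    then show ?thesis
      using ev by simp
  next
    case (square p)
    have pn: "p dvd n"
      using square(2) unfolding power2_eq_square by (rule dvd_mult_left)
    have p0: "p > 0"
      using square prime_gt_0_nat by blast
    have np: "n div p < n"
      using n0 prime_gt_1_nat[OF square(1)] by simp
    have z': "primitive_root (n div p) (z ^ p)"
      by (rule primitive_root_power_dvd[OF z pn])
    have div_dvd: "n div p dvd n"
      by (rule div_dvd_iff_mult[THEN iffD2]) (use pn p0 in auto)
    have primes': "\<forall>q. prime q \<longrightarrow> q dvd n div p \<longrightarrow> q = 2 \<or> q \<ge> 7"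
      using primes dvd_trans[OF _ div_dvd] by blast
    show ?thesis
    proof (rule even_fibres_split[OF I p0, where e = e])
      fix a u assume a: "a < p" and c7: "card {i \<in> I. e i mod p = a} \<noteq> 7"
      define J where "J = {i \<in> I. e i mod p = a}"
      have fin: "finite J" and "card J \<le> card I"
        using I by (auto simp: J_def intro: card_mono)
      then have cJ: "card J \<le> 8" "card J \<noteq> 7"
        using I c7 by (auto simp: J_def)
      have e: "z ^ e i = z ^ a * (z ^ p) ^ (e i div p)" if "i \<in> J" for i
        using that by (auto simp: J_def simp flip: power_mult power_add)
      obtain g where g: "ipoly (residue_part p a b) z = z ^ a * ipoly g (z ^ p)"
        using ipoly_residue_part_power by blast
      \<comment> \<open>Each class satisfies a relation of its own, which after division by
        \<open>z ^ a\<close> concerns the root \<open>z ^ p\<close> of smaller order.\<close>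
      have "(\<Sum>i\<in>J. z ^ e i) - 2 * ipoly (residue_part p a b) z = 0"
        using residue_part_root_square[OF z square f a]
        unfolding f_def residue_part_relation[OF I(1)] J_def by simp
      then have "z ^ a * (\<Sum>i\<in>J. (z ^ p) ^ (e i div p)) = z ^ a * (2 * ipoly g (z ^ p))"
        by (simp add: g e sum_distrib_left)
      then have "(\<Sum>i\<in>J. (z ^ p) ^ (e i div p)) = 2 * ipoly g (z ^ p)"
        using primitive_root_nonzero[OF z] by simp
      then have "even (card {i \<in> J. ((z ^ p) ^ (e i div p))\<^sup>2 = u / (z ^ a)\<^sup>2})"
        by (rule less.IH[OF np z' primes' fin cJ])
      also have "{i \<in> J. ((z ^ p) ^ (e i div p))\<^sup>2 = u / (z ^ a)\<^sup>2} = {i \<in> J. (z ^ e i)\<^sup>2 = u}"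
        using primitive_root_nonzero[OF z] by (auto simp: e power_mult_distrib field_simps)
      finally show "even (card {i \<in> {i \<in> I. e i mod p = a}. (z ^ e i)\<^sup>2 = u})"
        by (simp add: J_def)
    qed
  next
    case (simple p)
    have p0: "p > 0"
      using simple by simp
    have np: "n div p < n"
      using n0 simple by simp
    obtain y w where y: "primitive_root (n div p) y" "y = z * w" "w ^ p = 1"
      and inv: "\<And>f a. ipoly f z = 0 \<Longrightarrow> a < p \<Longrightarrow> of_nat p * ipoly (residue_part p a f) y = ipoly f y"
      by (rule residue_part_root_simple[OF z simple(1,3,4)]) (rule that)
    have w0: "w \<noteq> 0"
      using y(3) p0 by (auto simp: zero_power)
    have div_dvd: "n div p dvd n"
      by (rule div_dvd_iff_mult[THEN iffD2]) (use simple(3) p0 in auto)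
    have primes': "\<forall>q. prime q \<longrightarrow> q dvd n div p \<longrightarrow> q = 2 \<or> q \<ge> 7"
      using primes dvd_trans[OF _ div_dvd] by blast
    define J where "J a = {i \<in> I. e i mod p = a}" for a
    have J: "finite (J a)" "card (J a) \<le> 8" for a
    proof -
      show "finite (J a)"
        using I by (simp add: J_def)
      have "card (J a) \<le> card I"
        using I by (auto simp: J_def intro: card_mono)
      then show "card (J a) \<le> 8"
        using I by simp
    qed
    define \<alpha> where "\<alpha> a = (\<Sum>i\<in>J a. y ^ e i)" for a
    define \<beta> where "\<beta> a = ipoly (residue_part p a b) y" for a
    \<comment> \<open>By \<open>inv\<close>, \<open>p\<close> times either side is the value at
      \<open>y\<close> of the whole relation, whatever the class.\<close>
    have const: "\<alpha> a - 2 * \<beta> a = \<alpha> a' - 2 * \<beta> a'" if "a < p" "a' < p" for a a'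
    proof -
      have "of_nat p * (\<alpha> a - 2 * \<beta> a) = of_nat p * (\<alpha> a' - 2 * \<beta> a')"
        using inv[OF f that(1)] inv[OF f that(2)]
        unfolding f_def residue_part_relation[OF I(1)] \<alpha>_def \<beta>_def J_def by simp
      then show ?thesis
        using p0 by simp
    qed
    \<comment> \<open>Otherwise \<open>p = 7\<close> with class sizes \<open>2, 1, \<dots>, 1\<close>, and two classes of different
      parity give a relation with three terms.\<close>
    have empty: "\<exists>a<p. J a = {}"
    proof (rule ccontr)
      assume "\<not> ?thesis"
      then have pos: "card (J a) \<ge> 1" if "a < p" for a
        using that J(1) by (simp add: Suc_le_eq card_gt_0_iff)
      have cI: "card I = (\<Sum>a<p. card (J a))"
        unfolding J_def by (rule card_eq_sum_residues[OF I(1) p0])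
      have "p * 1 \<le> card I"
        unfolding cI using sum_mono[of "{..<p}" "\<lambda>_. 1" "\<lambda>a. card (J a)"] pos by simp
      with I simple(2) have c8: "card I = 8"
        by linarith
      have odd_p: "odd p"
        using prime_odd_nat[OF simple(1)] simple(2) by simp
      \<comment> \<open>An odd number of odd class sizes cannot add up to 8.\<close>
      have "\<exists>a<p. even (card (J a))"
      proof (rule ccontr)
        assume "\<not> ?thesis"
        then have "{a \<in> {..<p}. odd (card (J a))} = {..<p}"
          by auto
        then have "even (\<Sum>a<p. card (J a)) \<longleftrightarrow> even (card {..<p})"
          by (simp only: even_sum_iff finite_lessThan)
        then show False
          using cI c8 odd_p by simp
      qed
      then obtain a where a: "a < p" "even (card (J a))"
        by blast
      \<comment> \<open>Nonempty classes of even size have at least two elements each, hence at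
        least 14 in total.\<close>
      have "\<exists>a'<p. odd (card (J a'))"
      proof (rule ccontr)
        assume no: "\<not> ?thesis"
        have "2 \<le> card (J a')" if "a' < p" for a'
          using no pos[OF that] that by (cases "card (J a') = 1") auto
        then have "p * 2 \<le> card I"
          unfolding cI using sum_mono[of "{..<p}" "\<lambda>_. 2" "\<lambda>a. card (J a)"] by simp
        then show False
          using c8 simple(2) by simp
      qed
      then obtain a' where a': "a' < p" "odd (card (J a'))"
        by blast
      have ne: "a \<noteq> a'"
        using a a' by auto
      have disj: "J a \<inter> J a' = {}"
        using ne by (auto simp: J_def)
      have card_Un: "card (J a \<union> J a') = card (J a) + card (J a')"
        using J disj by (simp add: card_Un_disjoint)
      have "(\<Sum>b\<in>{..<p} - {a, a'}. 1) \<le> (\<Sum>b\<in>{..<p} - {a, a'}. card (J b))"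
        using pos by (intro sum_mono) auto
      moreover have "card I = card (J a) + card (J a') + (\<Sum>b\<in>{..<p} - {a, a'}. card (J b))"
      proof -
        have "{..<p} = insert a (insert a' ({..<p} - {a, a'}))"
          using a a' by auto
        then have "card I = (\<Sum>b\<in>insert a (insert a' ({..<p} - {a, a'})). card (J b))"
          using cI by simp
        then show ?thesis
          using ne by simp
      qed
      moreover have "card ({..<p} - {a, a'}) = p - 2"
        using a a' ne by (simp add: card_Diff_subset)
      ultimately have small: "card (J a \<union> J a') \<le> 3"
        using c8 simple(2) card_Un by simp
      have "(\<Sum>i\<in>J a \<union> J a'. y ^ e i) = \<alpha> a + \<alpha> a'"
        using J disj by (simp add: \<alpha>_def sum.union_disjoint)
      \<comment> \<open>By \<open>const\<close> the two class sums differ by twice an element of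
        Z[y]; adding twice \<open>\<alpha> a'\<close> turns the difference into the sum.\<close>
      also have "\<dots> = 2 * ipoly (residue_part p a b - residue_part p a' b + (\<Sum>i\<in>J a'. monom 1 (e i))) y"
        using const[OF a(1) a'(1)] by (simp add: \<beta>_def \<alpha>_def algebra_simps)
      finally have rel: "(\<Sum>i\<in>J a \<union> J a'. y ^ e i) =
          2 * ipoly (residue_part p a b - residue_part p a' b + (\<Sum>i\<in>J a'. monom 1 (e i))) y" .
      have "even (card {i \<in> J a \<union> J a'. (y ^ e i)\<^sup>2 = u})" for u
        by (rule less.IH[OF np y(1) primes' _ _ _ rel]) (use small J in auto)
      then have "even (card (J a \<union> J a'))"
        using even_card_if_even_fibres[of "J a \<union> J a'" "\<lambda>i. (y ^ e i)\<^sup>2"] J(1) by blast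
      then show False
        using card_Un a a' by simp
    qed
    then obtain a0 where a0: "a0 < p" "J a0 = {}"
      by blast
    \<comment> \<open>The empty class makes the common value of \<open>const\<close> a multiple of
      2, so every class sum vanishes modulo 2.\<close>
    have \<alpha>: "\<alpha> a = 2 * ipoly (residue_part p a b - residue_part p a0 b) y" if "a < p" for a
      using const[OF that a0(1)] a0(2) by (simp add: \<beta>_def \<alpha>_def algebra_simps)
    show ?thesis
    proof (rule even_fibres_split[OF I p0, where e = e])
      fix a u assume a: "a < p" and c7: "card {i \<in> I. e i mod p = a} \<noteq> 7"
      have e: "y ^ e i = w ^ a * z ^ e i" if "i \<in> J a" for i
      proof -
        have "w ^ e i = w ^ (p * (e i div p) + a)"
          using that by (auto simp: J_def)
        also have "\<dots> = w ^ a"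
          using y(3) by (simp only: power_add power_mult power_one mult_1)
        finally show ?thesis
          by (simp add: y(2) power_mult_distrib)
      qed
      have "even (card {i \<in> J a. (y ^ e i)\<^sup>2 = u * (w ^ a)\<^sup>2})"
        by (rule less.IH[OF np y(1) primes' J _ \<alpha>[OF a, unfolded \<alpha>_def]]) (use c7 in \<open>simp add: J_def\<close>)
      also have "{i \<in> J a. (y ^ e i)\<^sup>2 = u * (w ^ a)\<^sup>2} = {i \<in> J a. (z ^ e i)\<^sup>2 = u}"
        using w0 by (auto simp: e power_mult_distrib)
      finally show "even (card {i \<in> {i \<in> I. e i mod p = a}. (z ^ e i)\<^sup>2 = u})"
        by (simp add: J_def)
    qed
  qed
qed

subsection \<open>Products of tangents\<close>

text \<open>The powers of \<open>z\<close> are \<open>n\<close> distinct \<open>n\<close>-th roots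
  of unity, hence all of them; an even exponent would give order at most
  \<open>n div 2\<close>.\<close>

lemma primitive_root_exponent:
  assumes z: "primitive_root n z" and w: "primitive_root n w" and n: "even n"
  obtains c where "w = z ^ c" "odd c"
proof -
  have n0: "n > 0"
    using z by (simp add: primitive_root_def)
  have inj: "inj_on (\<lambda>j. z ^ j) {..<n}"
  proof (rule linorder_inj_onI)
    fix i j assume ij: "i < j" "i \<in> {..<n}" "j \<in> {..<n}"
    show "z ^ i \<noteq> z ^ j"
    proof
      assume "z ^ i = z ^ j"
      also have "\<dots> = z ^ i * z ^ (j - i)"
        using ij by (simp flip: power_add)
      finally have "z ^ (j - i) = 1"
        using primitive_root_nonzero[OF z] by simp
      then have "n dvd j - i"
        using z by (simp add: primitive_root_def)
      then show False
        using ij by (auto dest: dvd_imp_le)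
    qed
  qed auto
  have sub: "(\<lambda>j. z ^ j) ` {..<n} \<subseteq> {w. w ^ n = 1}"
    using z by (auto simp: primitive_root_def simp flip: power_mult)
  have "card ((\<lambda>j. z ^ j) ` {..<n}) = card {w :: complex. w ^ n = 1}"
    using inj n0 by (simp add: card_image card_roots_unity_eq)
  then have "(\<lambda>j. z ^ j) ` {..<n} = {w. w ^ n = 1}"
    using sub n0 by (intro card_subset_eq finite_roots_unity) auto
  moreover have "w \<in> {w. w ^ n = 1}"
    using w by (simp add: primitive_root_def)
  ultimately obtain c where c: "w = z ^ c"
    by auto
  have "odd c"
  proof
    assume "even c"
    then have "n dvd c * (n div 2)"
      using n by (auto elim!: evenE)
    then have "w ^ (n div 2) = 1"
      using z unfolding c by (simp add: primitive_root_def flip: power_mult)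
    then have "n dvd n div 2"
      using w by (simp add: primitive_root_def)
    then show False
      using n n0 by (auto elim!: evenE dest: dvd_imp_le)
  qed
  with c show ?thesis
    using that by blast
qed

section \<open>Divisibility by \<open>1 + z^2\<close>\<close>

lemma one_plus_square_nonzero:
  assumes z: "primitive_root n z" and n: "8 dvd n"
  shows "1 + z\<^sup>2 \<noteq> 0"
proof
  assume "1 + z\<^sup>2 = 0"
  then have "z ^ 2 = - 1"
    using minus_unique[of 1 "z ^ 2"] by simp
  then have "(z ^ 2) ^ 2 = 1"
    by simp
  then have "z ^ 4 = 1"
    by (simp flip: power_mult)
  then have "n dvd 4"
    using z by (simp add: primitive_root_def)
  then show False
    using n by (auto dest!: dvd_imp_le elim!: dvdE)
qed

text \<open>With \<open>w = - (z ^ 2)\<close>, \<open>1 - w\<close> divides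
  \<open>1 - w ^ c\<close>, which settles \<open>1 + z ^ (2 * c)\<close> for odd \<open>c\<close>.
  For even \<open>c\<close> the sign is absorbed by \<open>z ^ (n div 2) = - 1\<close>: this shifts
  \<open>c\<close> by \<open>n div 4\<close>, which is even because 8 divides
  \<open>n\<close>.\<close>

lemma sum_of_two_powers_dvd:
  assumes z: "primitive_root n z" and n: "8 dvd n" and ab: "even (a + b)"
  shows "\<exists>g. z ^ a + z ^ b = (1 + z\<^sup>2) * ipoly g z"
proof -
  define w where "w = - (z ^ 2)"
  have *: "\<exists>g. 1 - w ^ c = (1 + z\<^sup>2) * ipoly g z" for c
  proof
    have "ipoly (- monom 1 2) z = w"
      by (simp add: w_def)
    then show "1 - w ^ c = (1 + z\<^sup>2) * ipoly (\<Sum>i<c. (- monom 1 2) ^ i) z"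
      by (simp only: ipoly_sum ipoly_power one_diff_power_eq) (simp add: w_def)
  qed
  have "(z ^ (n div 2))\<^sup>2 = 1"
  proof -
    have "n div 2 * 2 = n"
      using n by (auto elim!: dvdE)
    then have "(z ^ (n div 2))\<^sup>2 = z ^ n"
      by (simp flip: power_mult)
    then show ?thesis
      using z by (simp add: primitive_root_def)
  qed
  moreover have "z ^ (n div 2) \<noteq> 1"
    using z n by (auto simp: primitive_root_def dest!: dvd_imp_le)
  ultimately have half: "z ^ (n div 2) = - 1"
    by (simp add: power2_eq_1_iff)
  have **: "\<exists>g. 1 + (z ^ 2) ^ c = (1 + z\<^sup>2) * ipoly g z" for c
  proof (cases "even c")
    case True
    then have "even (c + n div 4)"
      using n by (auto elim!: dvdE)
    then have "w ^ (c + n div 4) = (z ^ 2) ^ (c + n div 4)"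
      by (simp add: w_def)
    also have "\<dots> = (z ^ 2) ^ c * z ^ (2 * (n div 4))"
      by (simp add: power_add power_mult)
    also have "2 * (n div 4) = n div 2"
      using n by (auto elim!: dvdE)
    finally show ?thesis
      using *[of "c + n div 4"] by (simp add: half)
  next
    case False
    then show ?thesis
      using *[of c] by (simp add: w_def)
  qed
  have le: "\<exists>g. z ^ a + z ^ b = (1 + z\<^sup>2) * ipoly g z" if "a \<le> b" "even (a + b)" for a b
  proof -
    have "even (b - a)"
      using that by simp
    then obtain c where "b - a = 2 * c"
      by (elim evenE)
    then have c: "b = a + 2 * c"
      using that by simp
    obtain g where g: "1 + (z ^ 2) ^ c = (1 + z\<^sup>2) * ipoly g z"
      using ** by blast
    have "z ^ a + z ^ b = z ^ a * (1 + (z ^ 2) ^ c)"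
      unfolding c by (simp only: power_add power_mult distrib_left mult_1_right)
    also have "\<dots> = (1 + z\<^sup>2) * ipoly (monom 1 a * g) z"
      unfolding g by simp
    finally show ?thesis
      by blast
  qed
  show ?thesis
  proof (cases "a \<le> b")
    case True
    then show ?thesis
      using le ab by blast
  next
    case False
    then have "\<exists>g. z ^ b + z ^ a = (1 + z\<^sup>2) * ipoly g z"
      using le[of b a] ab by (simp add: add.commute[of b a])
    then show ?thesis
      by (simp only: add.commute[of "z ^ b"])
  qed
qed

text \<open>Indexing by list positions keeps repeated exponents apart and turns the fibre size into
  a sum of truth values, to be evaluated term by term.\<close>

lemma parity_of_list_fibres:
  assumes z: "primitive_root n z" and primes: "\<forall>q. prime q \<longrightarrow> q dvd n \<longrightarrow> q = 2 \<or> q \<ge> 7"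
    and "length es \<le> 8" "length es \<noteq> 7" "(\<Sum>c\<leftarrow>es. z ^ c) = 2 * ipoly b z"
  shows "even (\<Sum>c\<leftarrow>es. of_bool ((z ^ c)\<^sup>2 = u) :: nat)"
proof -
  have "even (card {i \<in> {..<length es}. (z ^ (es ! i))\<^sup>2 = u})"
    using assms(3-5)
    by (intro even_fibres_of_vanishing_mod_2[OF z primes, where b = b])
      (auto simp: sum_list_sum_nth atLeast0LessThan)
  also have "card {i \<in> {..<length es}. (z ^ (es ! i))\<^sup>2 = u} =
      (\<Sum>i<length es. of_bool ((z ^ (es ! i))\<^sup>2 = u))"
    unfolding card_eq_sum of_bool_def by (rule sum.inter_filter) simp
  also have "\<dots> = (\<Sum>c\<leftarrow>es. of_bool ((z ^ c)\<^sup>2 = u))"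
    by (simp add: sum_list_sum_nth atLeast0LessThan)
  finally show ?thesis .
qed

section \<open>Tangent equations as relations between roots of unity\<close>

text \<open>Factoring \<open>cis x\<close> out of \<open>cis (2 * x) - 1\<close> and
  \<open>cis (2 * x) + 1\<close> leaves \<open>2 * \<i> * sin x\<close> and
  \<open>2 * cos x\<close>.\<close>

lemma cis_double_minus_one:
  assumes "cos x \<noteq> 0"
  shows "cis (2 * x) - 1 = \<i> * of_real (tan x) * (cis (2 * x) + 1)"
proof -
  have "cis (2 * x) = cis x * cis x"
    by (simp add: cis_mult)
  moreover have "(cis x - cnj (cis x)) = 2 * \<i> * of_real (sin x)" "(cis x + cnj (cis x)) = 2 * of_real (cos x)"
    by (simp_all add: complex_eq_iff)
  moreover have "cis x * cnj (cis x) = 1"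
    by (simp add: cis_cnj cis_mult)
  ultimately have "cis (2 * x) - 1 = cis x * (2 * \<i> * of_real (sin x))"
    "cis (2 * x) + 1 = cis x * (2 * of_real (cos x))"
    by (metis right_diff_distrib) (metis \<open>cis (2 * x) = cis x * cis x\<close> \<open>cis x * cnj (cis x) = 1\<close>
      \<open>cis x + cnj (cis x) = 2 * of_real (cos x)\<close> distrib_left)
  then show ?thesis
    using assms by (simp add: tan_def field_simps)
qed

lemma cis_eq_one_imp: "cis t = 1 \<Longrightarrow> \<exists>k :: int. t = of_int k * (2 * pi)"
  by (metis cis.sel(1) cos_one_2pi_int mult.assoc one_complex.sel(1))

text \<open>The difference of the arguments is a multiple of \<open>2 * pi\<close> of absolute value
  below \<open>2 * pi\<close>. So comparing squares of the roots \<open>cis (2 * x)\<close> loses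
  nothing in this range.\<close>

lemma cis_4_inj:
  assumes "cis (4 * x) = cis (4 * y)" "0 < x" "x < pi / 2" "0 < y" "y < pi / 2"
  shows "x = y"
proof -
  have "cis (4 * x - 4 * y) = 1"
    using assms(1) by (simp flip: cis_divide)
  then obtain k :: int where k: "4 * x - 4 * y = of_int k * (2 * pi)"
    using cis_eq_one_imp by blast
  have "\<bar>of_int k\<bar> * (2 * pi) < 1 * (2 * pi)"
  proof -
    have "\<bar>of_int k\<bar> * (2 * pi) = \<bar>4 * x - 4 * y\<bar>"
      unfolding k by (simp add: abs_mult)
    then show ?thesis
      using assms by linarith
  qed
  then have "\<bar>of_int k :: real\<bar> < 1"
    by (rule mult_right_less_imp_less) simp
  then have "k = 0"
    by linarith
  then show ?thesis
    using k by simp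
qed

lemma cis_4_sum_eq_one:
  assumes "cis (4 * (x + y)) = 1" "0 < x" "x < pi / 2" "0 < y" "y < pi / 2"
  shows "x + y = pi / 2"
proof -
  obtain k :: int where k: "4 * (x + y) = of_int k * (2 * pi)"
    using cis_eq_one_imp assms(1) by blast
  have k1: "0 * (2 * pi) < of_int k * (2 * pi)" and k2: "of_int k * (2 * pi) < 2 * (2 * pi)"
    using assms unfolding k[symmetric] by auto
  have "0 < real_of_int k" "real_of_int k < 2"
    by (rule mult_right_less_imp_less[OF k1], simp) (rule mult_right_less_imp_less[OF k2], simp)
  then have "k = 1"
    by linarith
  then show ?thesis
    using k by simp
qed

lemma halve_mod_one_plus_square:
  assumes "primitive_root n z" "8 dvd n" "s * (1 + z\<^sup>2) = 2 * ((1 + z\<^sup>2) * t)"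
  shows "s = 2 * t"
  using assms(3) one_plus_square_nonzero[OF assms(1,2)] by simp

lemma tan_sq_eq_tan_mult_tan:
  fixes x y y' :: real
  assumes n: "8 dvd n" and primes: "\<forall>q. prime q \<longrightarrow> q dvd n \<longrightarrow> q = 2 \<or> q \<ge> 7"
    and roots: "\<forall>t\<in>{x, y, y'}. primitive_root n (cis (2 * t))"
    and bounds: "\<forall>t\<in>{x, y, y'}. 0 < t \<and> t < pi / 2"
    and tan: "(tan x)\<^sup>2 = tan y * tan y'"
  shows "y = x \<and> y' = x"
proof -
  define z where "z = cis (2 * x)"
  have z: "primitive_root n z"
    using roots by (simp add: z_def)
  have ev: "even n"
    using n by (auto elim!: dvdE)
  obtain c where c: "cis (2 * y) = z ^ c" "odd c"
    using primitive_root_exponent[OF z _ ev, of "cis (2 * y)"] roots by auto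
  obtain c' where c': "cis (2 * y') = z ^ c'" "odd c'"
    using primitive_root_exponent[OF z _ ev, of "cis (2 * y')"] roots by auto
  define w w' where "w = z ^ c" and "w' = z ^ c'"
  have cos_nz: "cos t \<noteq> 0" if "t \<in> {x, y, y'}" for t
    using bounds that cos_gt_zero_pi[of t] by fastforce
  have eqs: "z - 1 = \<i> * of_real (tan x) * (z + 1)" "w - 1 = \<i> * of_real (tan y) * (w + 1)"
    "w' - 1 = \<i> * of_real (tan y') * (w' + 1)"
    unfolding w_def w'_def c(1)[symmetric] c'(1)[symmetric] unfolding z_def
    by (rule cis_double_minus_one[OF cos_nz], simp)+
  have "(z - 1)\<^sup>2 * ((w + 1) * (w' + 1)) = - of_real ((tan x)\<^sup>2) * (z + 1)\<^sup>2 * ((w + 1) * (w' + 1))"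
    unfolding eqs(1) by (simp add: power_mult_distrib)
  also have "\<dots> = (z + 1)\<^sup>2 * ((w - 1) * (w' - 1))"
    unfolding tan eqs(2,3) by (simp add: algebra_simps)
  finally have eq: "(z - 1)\<^sup>2 * ((w + 1) * (w' + 1)) = (z + 1)\<^sup>2 * ((w - 1) * (w' - 1))" .
  have "2 * ((w + w') * (1 + z\<^sup>2) - 2 * (z * (1 + w * w'))) =
      (z - 1)\<^sup>2 * ((w + 1) * (w' + 1)) - (z + 1)\<^sup>2 * ((w - 1) * (w' - 1))"
    by (simp add: algebra_simps power2_eq_square)
  then have key: "(w + w') * (1 + z\<^sup>2) = 2 * (z * (1 + w * w'))"
    using eq by simp
  obtain g where g: "z ^ 0 + z ^ (c + c') = (1 + z\<^sup>2) * ipoly g z"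
    using sum_of_two_powers_dvd[OF z n, of 0 "c + c'"] c c' by auto
  have "2 * (z * (1 + w * w')) = 2 * ((1 + z\<^sup>2) * ipoly (monom 1 1 * g) z)"
    using g by (simp add: w_def w'_def power_add)
  with key have "(w + w') * (1 + z\<^sup>2) = 2 * ((1 + z\<^sup>2) * ipoly (monom 1 1 * g) z)"
    by (rule trans)
  then have "w + w' = 2 * ipoly (monom 1 1 * g) z"
    by (rule halve_mod_one_plus_square[OF z n])
  then have "even (\<Sum>a\<leftarrow>[c, c']. of_bool ((z ^ a)\<^sup>2 = w\<^sup>2) :: nat)"
    by (intro parity_of_list_fibres[OF z primes, where b = "monom 1 1 * g"]) (simp_all add: w_def w'_def)
  \<comment> \<open>The fibre over the square of \<open>w\<close> contains the term
    \<open>w\<close>, so evenness forces the other term into it.\<close>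
  then have "w'\<^sup>2 = w\<^sup>2"
    by (auto simp: w_def w'_def of_bool_def split: if_splits)
  then have "cis (4 * y') = cis (4 * y)"
    unfolding w_def w'_def c(1)[symmetric] c'(1)[symmetric] by (simp add: power2_eq_square cis_mult)
  then have yy: "y' = y"
    using bounds by (intro cis_4_inj) auto
  have "tan x > 0" "tan y > 0"
    using bounds by (auto intro: tan_gt_zero)
  then have "tan x = tan y"
    using tan unfolding yy power2_eq_square[symmetric] by (simp add: power2_eq_iff)
  moreover have "arctan (tan t) = t" if "t \<in> {x, y}" for t
  proof -
    have "0 < t" "t < pi / 2"
      using bounds that by auto
    then show ?thesis
      by (intro arctan_tan) linarith+
  qed
  ultimately have "x = y"
    by (metis insertI1 insertI2)
  with yy show ?thesis
    by simp
qed

text \<open>For \<open>qi = cis (4 * yi)\<close> the eight products are the squares of the eight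
  terms of \<open>S\<close>; the condition is the parity of their fibres.\<close>

definition even_pair_products :: "complex \<Rightarrow> complex \<Rightarrow> complex \<Rightarrow> complex \<Rightarrow> bool" where
  "even_pair_products q1 q2 q3 q4 \<longleftrightarrow>
    (\<forall>u. even (of_bool (1 = u) + of_bool (q1 * q2 * q3 * q4 = u) + of_bool (q1 * q2 = u)
      + of_bool (q3 * q4 = u) + of_bool (q1 * q3 = u) + of_bool (q2 * q4 = u)
      + of_bool (q1 * q4 = u) + of_bool (q2 * q3 = u) :: nat))"

lemma tan_sq_eq_tan_mult_4_parity:
  fixes x y1 y2 y3 y4 :: real
  assumes n: "8 dvd n" and primes: "\<forall>q. prime q \<longrightarrow> q dvd n \<longrightarrow> q = 2 \<or> q \<ge> 7"
    and roots: "\<forall>t\<in>{x, y1, y2, y3, y4}. primitive_root n (cis (2 * t))"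
    and bounds: "\<forall>t\<in>{x, y1, y2, y3, y4}. 0 < t \<and> t < pi / 2"
    and tan: "(tan x)\<^sup>2 = tan y1 * tan y2 * tan y3 * tan y4"
  shows "even_pair_products (cis (4 * y1)) (cis (4 * y2)) (cis (4 * y3)) (cis (4 * y4))"
proof -
  define q1 q2 q3 q4 where q: "q1 = cis (4 * y1)" "q2 = cis (4 * y2)" "q3 = cis (4 * y3)" "q4 = cis (4 * y4)"
  define z where "z = cis (2 * x)"
  have z: "primitive_root n z"
    using roots by (simp add: z_def)
  have ev: "even n"
    using n by (auto elim!: dvdE)
  have ex: "\<exists>c. cis (2 * t) = z ^ c \<and> odd c" if "t \<in> {y1, y2, y3, y4}" for t
    using primitive_root_exponent[OF z _ ev, of "cis (2 * t)"] roots that by blast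
  obtain c1 where c1: "cis (2 * y1) = z ^ c1" "odd c1"
    using ex[of y1] by auto
  obtain c2 where c2: "cis (2 * y2) = z ^ c2" "odd c2"
    using ex[of y2] by auto
  obtain c3 where c3: "cis (2 * y3) = z ^ c3" "odd c3"
    using ex[of y3] by auto
  obtain c4 where c4: "cis (2 * y4) = z ^ c4" "odd c4"
    using ex[of y4] by auto
  define w1 w2 w3 w4 where "w1 = z ^ c1" and "w2 = z ^ c2" and "w3 = z ^ c3" and "w4 = z ^ c4"
  note w_defs = w1_def w2_def w3_def w4_def
  have cos_nz: "cos t \<noteq> 0" if "t \<in> {x, y1, y2, y3, y4}" for t
    using bounds that cos_gt_zero_pi[of t] by fastforce
  have eqs: "z - 1 = \<i> * of_real (tan x) * (z + 1)" "w1 - 1 = \<i> * of_real (tan y1) * (w1 + 1)"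
    "w2 - 1 = \<i> * of_real (tan y2) * (w2 + 1)" "w3 - 1 = \<i> * of_real (tan y3) * (w3 + 1)"
    "w4 - 1 = \<i> * of_real (tan y4) * (w4 + 1)"
    unfolding w_defs c1(1)[symmetric] c2(1)[symmetric] c3(1)[symmetric] c4(1)[symmetric] unfolding z_def
    by (rule cis_double_minus_one[OF cos_nz], simp)+
  define A where "A = (w1 - 1) * (w2 - 1) * (w3 - 1) * (w4 - 1)"
  define B where "B = (w1 + 1) * (w2 + 1) * (w3 + 1) * (w4 + 1)"
  define S where "S = 1 + w1 * w2 * w3 * w4 + w1 * w2 + w3 * w4 + w1 * w3 + w2 * w4 + w1 * w4 + w2 * w3"
  \<comment> \<open>The grouping exhibits \<open>D\<close> as pairs \<open>w1 + w2\<close> and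
    \<open>w3 + w4\<close> and their multiples, each divisible by \<open>1 + z^2\<close>.\<close>
  define D where "D = (w1 + w2) + (w3 + w4) + (w1 * w2 * w3 + w1 * w2 * w4) + (w1 * w3 * w4 + w2 * w3 * w4)"
  have "(\<i> * a1 * b1) * (\<i> * a2 * b2) * (\<i> * a3 * b3) * (\<i> * a4 * b4) =
      (\<i> * \<i>) * (\<i> * \<i>) * ((a1 * a2 * a3 * a4) * (b1 * b2 * b3 * b4))"
    for a1 a2 a3 a4 b1 b2 b3 b4 :: complex
    by (simp only: ac_simps)
  then have "A = of_real (tan y1 * tan y2 * tan y3 * tan y4) * B"
    unfolding A_def B_def eqs(2-5) by (simp only: i_squared of_real_mult) simp
  moreover have "(z - 1)\<^sup>2 = - of_real ((tan x)\<^sup>2) * (z + 1)\<^sup>2"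
    unfolding eqs(1) by (simp add: power_mult_distrib)
  ultimately have eq: "(z - 1)\<^sup>2 * B + (z + 1)\<^sup>2 * A = 0"
    unfolding tan by simp
  have sums: "A + B = 2 * S" "B - A = 2 * D"
    unfolding A_def B_def S_def D_def by (simp_all add: algebra_simps)
  have "(z - 1)\<^sup>2 * B + (z + 1)\<^sup>2 * A = (1 + z\<^sup>2) * (A + B) - 2 * z * (B - A)"
    by (simp add: algebra_simps power2_eq_square)
  also have "\<dots> = 2 * (S * (1 + z\<^sup>2) - 2 * (z * D))"
    unfolding sums by (simp add: algebra_simps)
  finally have key: "S * (1 + z\<^sup>2) = 2 * (z * D)"
    using eq by simp
  have "\<exists>g. D = (1 + z\<^sup>2) * ipoly g z"
  proof -
    obtain g1 where g1: "w1 + w2 = (1 + z\<^sup>2) * ipoly g1 z"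
      using sum_of_two_powers_dvd[OF z n, of c1 c2] c1 c2 by (auto simp: w_defs)
    obtain g2 where g2: "w3 + w4 = (1 + z\<^sup>2) * ipoly g2 z"
      using sum_of_two_powers_dvd[OF z n, of c3 c4] c3 c4 by (auto simp: w_defs)
    have g3: "w1 * w2 * w3 + w1 * w2 * w4 = (1 + z\<^sup>2) * (z ^ (c1 + c2) * ipoly g2 z)"
      using g2 by (simp add: w_defs power_add flip: distrib_left)
    have g4: "w1 * w3 * w4 + w2 * w3 * w4 = (1 + z\<^sup>2) * (z ^ (c3 + c4) * ipoly g1 z)"
      using g1 by (simp add: w_defs power_add mult.assoc flip: distrib_right)
    have "D = (1 + z\<^sup>2) * ipoly (g1 + g2 + monom 1 (c1 + c2) * g2 + monom 1 (c3 + c4) * g1) z"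
      unfolding D_def g1 g2 g3 g4 by (simp add: distrib_left)
    then show ?thesis
      by blast
  qed
  then obtain g where "D = (1 + z\<^sup>2) * ipoly g z"
    by blast
  then have "S * (1 + z\<^sup>2) = 2 * ((1 + z\<^sup>2) * ipoly (monom 1 1 * g) z)"
    using key by simp
  then have S: "S = 2 * ipoly (monom 1 1 * g) z"
    by (rule halve_mod_one_plus_square[OF z n])
  have sq: "(z ^ c1)\<^sup>2 = q1" "(z ^ c2)\<^sup>2 = q2" "(z ^ c3)\<^sup>2 = q3" "(z ^ c4)\<^sup>2 = q4"
    unfolding q c1(1)[symmetric] c2(1)[symmetric] c3(1)[symmetric] c4(1)[symmetric]
    by (simp_all add: power2_eq_square cis_mult)
  have "even (\<Sum>a\<leftarrow>[0, c1 + c2 + c3 + c4, c1 + c2, c3 + c4, c1 + c3, c2 + c4, c1 + c4, c2 + c3].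
      of_bool ((z ^ a)\<^sup>2 = u) :: nat)" for u
    using S by (intro parity_of_list_fibres[OF z primes, where b = "monom 1 1 * g"]) (simp_all add: S_def w_defs power_add add.assoc mult.assoc simp_thms)
  then show ?thesis
    unfolding even_pair_products_def q[symmetric]
    by (simp only: list.map sum_list.Cons sum_list.Nil power_add power_mult_distrib sq
      power_0 power_one add_0_right add.assoc mult.assoc simp_thms)
qed

text \<open>If \<open>q1 = q2\<close>, the mixed products coincide in pairs, so only
  \<open>q3 * q4\<close> can match \<open>q1 * q2\<close>; the total product 1 then makes the square
  of \<open>q1 * q2\<close> equal to 1.\<close>

lemma pow4_eq_one_if_equal_pair:
  fixes q1 q2 q3 q4 :: complex
  assumes par: "even_pair_products q1 q2 q3 q4"
    and ne: "q1 * q2 \<noteq> 1" and prod: "q1 * q2 * q3 * q4 = 1" and eq: "q1 = q2"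
  shows "q1 ^ 4 = 1"
proof -
  have "q3 * q4 = q1 * q2"
    using par[unfolded even_pair_products_def, rule_format, of "q1 * q2"] ne prod unfolding eq by (auto simp: of_bool_def split: if_splits)
  then have "(q1 * q2) * (q1 * q2) = 1"
    using prod by (simp add: mult.assoc)
  then show ?thesis
    by (simp add: eq power4_eq_xxxx mult.assoc)
qed

text \<open>The term 1 can only be matched by the full product. For distinct \<open>qi\<close>,
  products sharing a factor differ, so complementary ones agree and equal -1, which contradicts
  distinctness. Hence two of the \<open>qi\<close> coincide and the preceding lemma applies.\<close>

lemma ex_pair_product_one:
  fixes q1 q2 q3 q4 :: complex
  assumes par: "even_pair_products q1 q2 q3 q4"
    and ne: "q1 * q2 \<noteq> 1" "q3 * q4 \<noteq> 1" "q1 * q3 \<noteq> 1" "q2 * q4 \<noteq> 1" "q1 * q4 \<noteq> 1" "q2 * q3 \<noteq> 1"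
    and nz: "q1 \<noteq> 0" "q2 \<noteq> 0" "q3 \<noteq> 0" "q4 \<noteq> 0"
  shows "q1 ^ 4 = 1 \<or> q2 ^ 4 = 1 \<or> q3 ^ 4 = 1"
proof -
  have prod: "q1 * q2 * q3 * q4 = 1"
    using par[unfolded even_pair_products_def, rule_format, of 1] ne by (auto simp: of_bool_def split: if_splits)
  have distinct: "q1 = q2 \<or> q1 = q3 \<or> q1 = q4 \<or> q2 = q3 \<or> q2 = q4 \<or> q3 = q4"
  proof (rule ccontr)
    assume no: "\<not> ?thesis"
    have A: "q3 * q4 = q1 * q2"
      using par[unfolded even_pair_products_def, rule_format, of "q1 * q2"] ne prod no nz by (auto simp: of_bool_def split: if_splits)
    have B: "q2 * q4 = q1 * q3"
      using par[unfolded even_pair_products_def, rule_format, of "q1 * q3"] ne prod no nz by (auto simp: of_bool_def split: if_splits)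
    have "(q1 * q2)\<^sup>2 = (q1 * q2) * (q3 * q4)" "(q1 * q3)\<^sup>2 = (q1 * q3) * (q2 * q4)"
      unfolding A B by (simp_all add: power2_eq_square)
    then have "(q1 * q2)\<^sup>2 = 1" "(q1 * q3)\<^sup>2 = 1"
      using prod by (simp_all add: ac_simps)
    then have "q1 * q2 = - 1" "q1 * q3 = - 1"
      using ne by (auto simp: power2_eq_1_iff)
    then have "q1 * q2 = q1 * q3"
      by simp
    then show False
      using no nz by simp
  qed
  \<comment> \<open>The parity condition is symmetric in the four arguments, so any coinciding pair
    may be moved to the front.\<close>
  have even_perms: "even_pair_products q1 q3 q2 q4" "even_pair_products q1 q4 q2 q3"
    "even_pair_products q2 q3 q1 q4" "even_pair_products q2 q4 q1 q3" "even_pair_products q3 q4 q1 q2"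
    using par unfolding even_pair_products_def by (simp_all only: ac_simps simp_thms)
  have prods: "q1 * q3 * q2 * q4 = 1" "q1 * q4 * q2 * q3 = 1" "q2 * q3 * q1 * q4 = 1"
    "q2 * q4 * q1 * q3 = 1" "q3 * q4 * q1 * q2 = 1"
    using prod by (simp_all only: ac_simps)
  from distinct show ?thesis
    using pow4_eq_one_if_equal_pair[OF par ne(1) prod]
      pow4_eq_one_if_equal_pair[OF even_perms(1) ne(3) prods(1)]
      pow4_eq_one_if_equal_pair[OF even_perms(2) ne(5) prods(2)]
      pow4_eq_one_if_equal_pair[OF even_perms(3) ne(6) prods(3)]
      pow4_eq_one_if_equal_pair[OF even_perms(4) ne(4) prods(4)]
      pow4_eq_one_if_equal_pair[OF even_perms(5) ne(2) prods(5)]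
    by blast
qed

section \<open>Denominators, and the existence of a complementary pair\<close>

lemma cis_eq_one_iff: "cis t = 1 \<longleftrightarrow> (\<exists>k :: int. t = of_int k * (2 * pi))"
  using cis_multiple_2pi[of "of_int _"] by (auto dest: cis_eq_one_imp simp: mult.commute)

text \<open>Writing \<open>x = a / n * pi\<close> in lowest terms, the \<open>k\<close>-th power is
  1 exactly when \<open>n\<close> divides \<open>k * a\<close>, that is, \<open>k\<close>.\<close>

lemma primitive_root_cis_den:
  assumes "x \<in> G" "den x = n" "n > 0"
  shows "primitive_root (nat n) (cis (2 * x))"
proof -
  obtain q where q: "x = of_rat q * pi"
    using assms(1) by (auto simp: G_def)
  have "(THE q'. of_rat q' = x / pi) = q"
    by (rule the_equality) (simp_all add: q)
  then have "snd (quotient_of q) = n"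
    using assms(2) by (simp add: den_def)
  then obtain a where a: "quotient_of q = (a, n)"
    by (metis prod.collapse)
  have cop: "coprime a n"
    by (rule quotient_of_coprime[OF a])
  have x: "x = of_int a / of_int n * pi"
    using quotient_of_div[OF a] by (simp add: q of_rat_divide)
  have "cis (2 * x) ^ k = 1 \<longleftrightarrow> nat n dvd k" for k
  proof -
    have "cis (2 * x) ^ k = 1 \<longleftrightarrow> (\<exists>m :: int. of_nat k * (2 * x) = of_int m * (2 * pi))"
      by (simp only: DeMoivre cis_eq_one_iff)
    also have "\<dots> \<longleftrightarrow> (\<exists>m :: int. real_of_int (int k * a) = of_int (m * n))"
      using assms(3) by (simp add: x field_simps)
    also have "\<dots> \<longleftrightarrow> n dvd int k * a"
      unfolding of_int_eq_iff by (auto simp: dvd_def mult.commute)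
    also have "\<dots> \<longleftrightarrow> n dvd int k"
      using cop by (simp add: coprime_dvd_mult_left_iff coprime_commute)
    also have "\<dots> \<longleftrightarrow> nat n dvd k"
      using assms(3) by (simp add: nat_dvd_iff)
    finally show ?thesis .
  qed
  then show ?thesis
    using assms(3) by (simp add: primitive_root_def)
qed

text \<open>The bounds leave \<open>y = k * pi / 8\<close> with \<open>k\<close> from 1 to 3, and
  \<open>k = 2\<close> gives a root of order 4.\<close>

lemma primitive_root_8_cis:
  assumes y: "primitive_root 8 (cis (2 * y))" "0 < y" "y < pi / 2"
  shows "y = pi / 8 \<or> y = pi / 2 - pi / 8"
proof -
  have "cis (2 * y) ^ 8 = 1"
    using y by (simp add: primitive_root_def)
  then obtain k :: int where k: "16 * y = of_int k * (2 * pi)"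
    by (auto simp: DeMoivre cis_eq_one_iff)
  have k1: "0 * (2 * pi) < of_int k * (2 * pi)" and k2: "of_int k * (2 * pi) < 4 * (2 * pi)"
    using y unfolding k[symmetric] by auto
  have "0 < real_of_int k" "real_of_int k < 4"
    by (rule mult_right_less_imp_less[OF k1], simp) (rule mult_right_less_imp_less[OF k2], simp)
  then have "k = 1 \<or> k = 2 \<or> k = 3"
    by linarith
  moreover have "k \<noteq> 2"
  proof
    assume "k = 2"
    then have "real 4 * (2 * y) = 2 * pi * 1"
      using k by simp
    then have "cis (2 * y) ^ 4 = 1"
      unfolding DeMoivre by (metis Ints_1 cis_multiple_2pi)
    then show False
      using y(1) by (simp add: primitive_root_def)
  qed
  ultimately show ?thesis
    using k by auto
qed

text \<open>Without such a pair some \<open>cis (4 * yi)\<close> is a fourth root of unity, so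
  \<open>n = 8\<close> and all angles are \<open>pi / 8\<close> or \<open>3 * pi / 8\<close>. Then
  the \<open>yi\<close> are all equal, \<open>x\<close> is \<open>y1\<close> or its complement, and
  either case forces \<open>tan y1 = 1\<close>, which fails at both angles.\<close>

lemma ex_complementary_pair:
  fixes x y1 y2 y3 y4 :: real
  assumes n: "8 dvd n" and primes: "\<forall>q. prime q \<longrightarrow> q dvd n \<longrightarrow> q = 2 \<or> q \<ge> 7"
    and roots: "\<forall>t\<in>{x, y1, y2, y3, y4}. primitive_root n (cis (2 * t))"
    and bounds: "\<forall>t\<in>{x, y1, y2, y3, y4}. 0 < t \<and> t < pi / 2"
    and tan: "(tan x)\<^sup>2 = tan y1 * tan y2 * tan y3 * tan y4"
  shows "y1 + y2 = pi / 2 \<or> y3 + y4 = pi / 2 \<or> y1 + y3 = pi / 2 \<or> y2 + y4 = pi / 2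
    \<or> y1 + y4 = pi / 2 \<or> y2 + y3 = pi / 2"
proof (rule ccontr)
  assume no: "\<not> ?thesis"
  have ne: "cis (4 * s) * cis (4 * t) \<noteq> 1"
    if "s + t \<noteq> pi / 2" "s \<in> {x, y1, y2, y3, y4}" "t \<in> {x, y1, y2, y3, y4}" for s t
  proof
    assume "cis (4 * s) * cis (4 * t) = 1"
    then have "cis (4 * (s + t)) = 1"
      by (simp add: cis_mult distrib_left)
    then show False
      using cis_4_sum_eq_one[of s t] bounds that by blast
  qed
  have "cis (4 * y1) ^ 4 = 1 \<or> cis (4 * y2) ^ 4 = 1 \<or> cis (4 * y3) ^ 4 = 1"
    using tan_sq_eq_tan_mult_4_parity[OF n primes roots bounds tan] no
    by (intro ex_pair_product_one[where ?q4.0 = "cis (4 * y4)"] ne) auto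
  moreover have "cis (4 * t) ^ 4 = cis (2 * t) ^ 8" for t
    by (simp add: DeMoivre)
  ultimately have "n dvd 8"
    using roots by (auto simp: primitive_root_def)
  with n have n8: "n = 8"
    by (rule dvd_antisym[rotated])
  have vals: "t = pi / 8 \<or> t = pi / 2 - pi / 8" if "t \<in> {x, y1, y2, y3, y4}" for t
    using roots bounds that unfolding n8 by (intro primitive_root_8_cis) auto
  have eqs: "y2 = y1" "y3 = y1" "y4 = y1"
  proof -
    have "y1 + y2 \<noteq> pi / 2" "y1 + y3 \<noteq> pi / 2" "y1 + y4 \<noteq> pi / 2"
      using no by blast+
    then show "y2 = y1" "y3 = y1" "y4 = y1"
      using vals[of y1] vals[of y2] vals[of y3] vals[of y4] by force+
  qed
  define T where "T = tan y1"
  have T: "T > 0"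
    using bounds by (simp add: T_def tan_gt_zero)
  have tan': "(tan x)\<^sup>2 = T ^ 4"
    using tan unfolding eqs T_def by (simp add: power4_eq_xxxx)
  have "T = 1"
  proof -
    have "x = y1 \<or> x = pi / 2 - y1"
      using vals[of x] vals[of y1] by auto
    then show ?thesis
    proof
      assume "x = y1"
      then have "T ^ 2 = T ^ 2 * T ^ 2"
        using tan' by (simp add: T_def power2_eq_square power4_eq_xxxx mult.assoc)
      then have "T ^ 2 = 1"
        unfolding mult_cancel_left1 using T by auto
      then show ?thesis
        using T by (simp add: power2_eq_1_iff)
    next
      assume "x = pi / 2 - y1"
      then have inv: "tan x = inverse T"
        by (simp add: T_def tan_cot)
      have "T ^ 6 = T ^ 2 * T ^ 4"
        by (simp flip: power_add)
      also have "\<dots> = (T * inverse T) ^ 2"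
        unfolding tan'[symmetric] inv by (simp add: power_mult_distrib)
      also have "\<dots> = 1"
        using T by simp
      finally have "T ^ 6 = 1" .
      then show ?thesis
        using T power_eq_imp_eq_base[of T 6 1] by simp
    qed
  qed
  then have "arctan (tan y1) = pi / 4"
    by (simp add: T_def arctan_one)
  moreover have "arctan (tan y1) = y1"
  proof -
    have "0 < y1" "y1 < pi / 2"
      using bounds by auto
    then show ?thesis
      by (intro arctan_tan) linarith+
  qed
  ultimately have "y1 = pi / 4"
    by simp
  moreover have "y1 = pi / 8 \<or> y1 = pi / 2 - pi / 8"
    by (rule vals) simp
  ultimately show False
    using pi_gt_zero by linarith
qed

section \<open>The permutation and the two parameters\<close>

theorem theorem11p14:
  fixes n :: int and x :: "nat \<Rightarrow> real"
  assumes "n \<ge> 8" and "8 dvd n"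
    and "\<forall>p. prime p \<and> p dvd n \<longrightarrow> p = 2 \<or> p > 5"
    and "\<forall>i\<in>{0..4}. x i \<in> G"
    and "(tan (x 0))\<^sup>2 = tan (x 1) * tan (x 2) * tan (x 3) * tan (x 4)"
    and "\<forall>i\<in>{0..4}. 0 < x i \<and> x i < pi / 2"
    and "\<forall>i\<in>{0..4}. den (x i) = n"
  shows "\<exists>(\<sigma> :: nat \<Rightarrow> nat) (s :: rat) (t :: rat).
    \<sigma> permutes {1..4} \<and> 0 < s \<and> s < 1 / 2 \<and> 0 < t \<and> t \<le> 1 / 4 \<and>
    x 0 = of_rat s * pi \<and> x (\<sigma> 1) = of_rat s * pi \<and> x (\<sigma> 2) = of_rat s * pi \<and>
    x (\<sigma> 3) = of_rat t * pi \<and> x (\<sigma> 4) = (1 / 2 - of_rat t) * pi"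
proof -
  have I: "{0..4} = {0, 1, 2, 3, 4 :: nat}" and J: "{1..4} = {1, 2, 3, 4 :: nat}"
    by auto
  define N where "N = nat n"
  have nN: "n = int N"
    using assms(1) by (simp add: N_def)
  have "int 8 dvd int N"
    using assms(2) by (simp add: nN)
  then have N: "8 dvd N"
    unfolding of_nat_dvd_iff .
  have primes: "\<forall>q. prime q \<longrightarrow> q dvd N \<longrightarrow> q = 2 \<or> q \<ge> 7"
  proof (intro allI impI)
    fix q assume q: "prime q" "q dvd N"
    then have "prime (int q)" "int q dvd n"
      by (simp_all add: nN)
    then have "int q = 2 \<or> int q > 5"
      using assms(3) by blast
    \<comment> \<open>Excluding 6 improves the bound \<open>q > 5\<close> to the required
      \<open>q \<ge> 7\<close>.\<close>
    moreover have "q \<noteq> 6"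
      using q(1) prime_product[of 2 3] by auto
    ultimately show "q = 2 \<or> q \<ge> 7"
      by auto
  qed
  have roots: "primitive_root N (cis (2 * x i))" if "i \<in> {0..4}" for i
    unfolding N_def using assms(1,4,7) that by (intro primitive_root_cis_den) simp_all
  have bounds: "0 < x i \<and> x i < pi / 2" if "i \<in> {0..4}" for i
    using assms(6) that by blast
  \<comment> \<open>Here \<open>i\<close> is the index of the smaller angle of the complementary
    pair, which supplies \<open>t\<close>.\<close>
  have concl: ?thesis
    if perm: "{k, l, i, j} = {1..4}"
      and eq: "x k = x 0" "x l = x 0" "x i + x j = pi / 2" "x i \<le> pi / 4" for i j k l
  proof -
    define \<sigma> where "\<sigma> = (\<lambda>m. if m = 1 then k else if m = 2 then l else if m = 3 then i
      else if m = 4 then j else m)"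
    have vals: "\<sigma> 1 = k" "\<sigma> 2 = l" "\<sigma> 3 = i" "\<sigma> 4 = j"
      by (simp_all add: \<sigma>_def)
    have "\<sigma> ` {1, 2, 3, 4} = {k, l, i, j}"
      by (simp only: image_insert image_empty vals)
    then have img: "\<sigma> ` {1..4} = {1..4}"
      unfolding perm J[symmetric] .
    \<comment> \<open>Distinctness of the four indices is not assumed: it follows because
      \<open>\<sigma>\<close> maps a finite set onto itself.\<close>
    have "inj_on \<sigma> {1..4}"
      by (rule eq_card_imp_inj_on) (simp_all only: img finite_atLeastAtMost)
    then have "bij_betw \<sigma> {1..4} {1..4}"
      using img by (simp add: bij_betw_def)
    then have "\<sigma> permutes {1..4}"
      by (rule bij_imp_permutes) (auto simp: \<sigma>_def)
    moreover obtain s where s: "x 0 = of_rat s * pi"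
      using assms(4) by (auto simp: I G_def)
    moreover obtain t where t: "x i = of_rat t * pi"
      using assms(4) perm unfolding I J G_def by blast
    moreover have "0 < s" "s < 1 / 2" "0 < t" "t \<le> 1 / 4"
    proof -
      have "i \<in> {0..4}"
        using perm unfolding I J by blast
      then have "0 < real_of_rat s * pi" "real_of_rat s * pi < 1 / 2 * pi"
        "0 < real_of_rat t * pi" "real_of_rat t * pi \<le> 1 / 4 * pi"
        using bounds[of 0] bounds[of i] eq(4) s t by auto
      then have "0 < real_of_rat s" "real_of_rat s < real_of_rat (1 / 2)"
        "0 < real_of_rat t" "real_of_rat t \<le> real_of_rat (1 / 4)"
        by (simp_all add: zero_less_mult_iff of_rat_divide)
      then show "0 < s" "s < 1 / 2" "0 < t" "t \<le> 1 / 4"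
        unfolding of_rat_less of_rat_less_eq zero_less_of_rat_iff by blast+
    qed
    moreover have "x j = (1 / 2 - of_rat t) * pi"
      using eq(3) t by (simp add: algebra_simps)
    ultimately show ?thesis
      using eq(1,2) vals by metis
  qed
  \<comment> \<open>The tangents of a complementary pair multiply to 1, which leaves the two-tangent
    equation for \<open>k\<close> and \<open>l\<close>.\<close>
  have main: ?thesis
    if perm: "{i, j, k, l} = {1..4}" and pair: "x i + x j = pi / 2"
      and tan: "(tan (x 0))\<^sup>2 = (tan (x i) * tan (x j)) * (tan (x k) * tan (x l))" for i j k l
  proof -
    have mem: "i \<in> {0..4}" "j \<in> {0..4}" "k \<in> {0..4}" "l \<in> {0..4}" "0 \<in> {0..4 :: nat}"
      using perm unfolding I J by blast+
    have "tan (x j) = inverse (tan (x i))"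
      using pair tan_cot[of "x i"] by (metis add_diff_cancel_left')
    moreover have "tan (x i) > 0"
      using bounds[OF mem(1)] by (simp add: tan_gt_zero)
    ultimately have "(tan (x 0))\<^sup>2 = tan (x k) * tan (x l)"
      using tan by simp
    then have eq: "x k = x 0" "x l = x 0"
      using tan_sq_eq_tan_mult_tan[OF N primes, of "x 0" "x k" "x l"] roots bounds mem by auto
    have perms: "{k, l, i, j} = {1..4}" "{k, l, j, i} = {1..4}"
      unfolding perm[symmetric] by auto
    show ?thesis
    proof (cases "x i \<le> pi / 4")
      case True
      then show ?thesis
        by (rule concl[OF perms(1) eq pair])
    next
      case False
      then have "x j \<le> pi / 4" "x j + x i = pi / 2"
        using pair by linarith+
      then show ?thesis
        using concl[OF perms(2) eq] by blast
    qed
  qed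
  have "x 1 + x 2 = pi / 2 \<or> x 3 + x 4 = pi / 2 \<or> x 1 + x 3 = pi / 2 \<or> x 2 + x 4 = pi / 2
    \<or> x 1 + x 4 = pi / 2 \<or> x 2 + x 3 = pi / 2"
    using roots bounds by (intro ex_complementary_pair[OF N primes _ _ assms(5)]) (auto simp: I)
  then show ?thesis
  proof (elim disjE)
    assume "x 1 + x 2 = pi / 2"
    then show ?thesis
      by (rule main[of 1 2 3 4, rotated]) (auto simp: assms(5) J ac_simps)
  next
    assume "x 3 + x 4 = pi / 2"
    then show ?thesis
      by (rule main[of 3 4 1 2, rotated]) (auto simp: assms(5) J ac_simps)
  next
    assume "x 1 + x 3 = pi / 2"
    then show ?thesis
      by (rule main[of 1 3 2 4, rotated]) (auto simp: assms(5) J ac_simps)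
  next
    assume "x 2 + x 4 = pi / 2"
    then show ?thesis
      by (rule main[of 2 4 1 3, rotated]) (auto simp: assms(5) J ac_simps)
  next
    assume "x 1 + x 4 = pi / 2"
    then show ?thesis
      by (rule main[of 1 4 2 3, rotated]) (auto simp: assms(5) J ac_simps)
  next
    assume "x 2 + x 3 = pi / 2"
    then show ?thesis
      by (rule main[of 2 3 1 4, rotated]) (auto simp: assms(5) J ac_simps)
  qed
qed

end
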